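(* Let $N\ge1$ and $b\ge1$ be integers and let $c>0$. The pseudo-distribution of $S_b^+$ is characterized by the following pseudo-probabilities: for any $\ell\in\{b,b+1,\dots,b+N-1\}$, $$\mathbb{P}\{S_b^+=\ell,\ \sigma_b^+<+\infty\}=(-1)^{b+\ell}\,\frac{b}{\ell}\binom{N-1}{\ell-b}\binom{b+N-1}{b}.$$ Moreover, $\mathbb{P}\{\sigma_b^+<+\infty\}=1$.
   Context: Pseudo-random walk: put $p_k=\delta_{k0}+(-1)^{k-1}c\binom{2N}{k+N}$ for $k\in\{-N,\dots,N\}$ (real numbers, possibly negative, summing to $1$). The $U_n$, $n\ge1$, are independent identically distributed pseudo-random variables (measurable functions on a space endowed with a signed measure of total mass one) with $\mathbb{P}\{U_n=k\}=p_k$, so that $\mathbb{P}\{U_1=k_1,\dots,U_n=k_n\}=p_{k_1}\cdots p_{k_n}$; $S_0=0$, $S_n=U_1+\dots+U_n$. First overshooting time: $\sigma_b^+=\min\{n\ge1:S_n\ge b\}$ ($\min\emptyset=+\infty$), and, when $\sigma_b^+<+\infty$, $S_b^+=S_{\sigma_b^+}\in\{b,\dots,b+N-1\}$; $\mathbb{P}\{\sigma_b^+=k,S_b^+=\ell\}=\mathbb{P}\{S_1<b,\dots,S_{k-1}<b,S_k=\ell\}$ for $k\ge1$. Pseudo-probabilities: with the generating function $H_{b,\ell}^+(z)=\sum_{k\ge1}\mathbb{P}\{\sigma_b^+=k,S_b^+=\ell\}z^k$, one has $\mathbb{P}\{S_b^+=\ell,\sigma_b^+<+\infty\}=H_{b,\ell}^+(1)=\sum_{k\ge1}\mathbb{P}\{\sigma_b^+=k,S_b^+=\ell\}$,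 and $\mathbb{P}\{\sigma_b^+<+\infty\}=\sum_{\ell=b}^{b+N-1}\mathbb{P}\{S_b^+=\ell,\sigma_b^+<+\infty\}$.
   Formalization: For large c (e.g. N=b=1, c>1/2) the series defining the pseudo-probability diverges; there it is read as the limit at 1 of the generating function continued analytically along [0,1). Where the series converges, its sum is meant; convergence is proved for c ≤ 1/2^(2N-1). *)

theory Defs
  imports "HOL-Complex_Analysis.Complex_Analysis" "HOL-Library.Extended_Nat"
begin

section \<open>The pseudo-random walk\<close>

definition step_weight :: "nat \<Rightarrow> real \<Rightarrow> int \<Rightarrow> real" where
  "step_weight N c k =
     (if k = 0 then 1 else 0) + (-1) powi (k - 1) * c * real ((2 * N) choose nat (k + int N))"

text \<open>
  The sample space is the space of all step sequences \<open>u\<close>, with \<open>u i\<close> (\<open>i \<ge> 1\<close>) the value of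
  the \<open>i\<close>-th step. Since the weights may be negative, with total variation larger than one, the joint
  law of all the steps is only a finitely additive signed measure on cylinder events.
  The number \<open>pseudo_prob N c n E\<close> is the pseudo-probability of \<open>E\<close> for an event \<open>E\<close> that is
  determined by the first \<open>n\<close> steps; it has no meaning for other events.
\<close>

definition pseudo_prob :: "nat \<Rightarrow> real \<Rightarrow> nat \<Rightarrow> (nat \<Rightarrow> int) set \<Rightarrow> real" where
  "pseudo_prob N c n E =
     (\<Sum>u\<in>({1..n} \<rightarrow>\<^sub>E {- int N..int N}) \<inter> E. \<Prod>i=1..n. step_weight N c (u i))"

definition walk :: "(nat \<Rightarrow> int) \<Rightarrow> nat \<Rightarrow> int" where
  "walk u n = (\<Sum>i=1..n. u i)"


section \<open>First overshooting of a level\<close>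

definition overshoot_time :: "int \<Rightarrow> (nat \<Rightarrow> int) \<Rightarrow> enat" where
  "overshoot_time b u = Inf {enat n | n. n \<ge> 1 \<and> walk u n \<ge> b}"

text \<open>Only meaningful when the overshooting time is finite.\<close>

definition overshoot_place :: "int \<Rightarrow> (nat \<Rightarrow> int) \<Rightarrow> int" where
  "overshoot_place b u = walk u (the_enat (overshoot_time b u))"

definition overshoot_coeff :: "nat \<Rightarrow> real \<Rightarrow> nat \<Rightarrow> nat \<Rightarrow> nat \<Rightarrow> real" where
  "overshoot_coeff N c b l k =
     pseudo_prob N c k {u. overshoot_time (int b) u = enat k \<and> overshoot_place (int b) u = int l}"

lemma overshoot_time_eq_enat_iff:
  "overshoot_time b u = enat k \<longleftrightarrow> k \<ge> 1 \<and> walk u k \<ge> b \<and> (\<forall>j\<in>{1..<k}. walk u j < b)"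
proof -
  let ?A = "{enat n | n. n \<ge> 1 \<and> walk u n \<ge> b}"
  show ?thesis
  proof
    assume *: "overshoot_time b u = enat k"
    have "?A \<noteq> {}"
    proof
      assume "?A = {}"
      hence "overshoot_time b u = \<infinity>"
        unfolding overshoot_time_def by (metis Inf_empty top_enat_def)
      with * show False by simp
    qed
    hence "Inf ?A \<in> ?A" by (meson wellorder_InfI ex_in_conv)
    hence 1: "k \<ge> 1 \<and> walk u k \<ge> b" using * by (auto simp: overshoot_time_def)
    have "walk u j < b" if "j \<in> {1..<k}" for j
    proof (rule ccontr)
      assume "\<not> walk u j < b"
      hence "enat j \<in> ?A" using that by auto
      hence "Inf ?A \<le> enat j" by (rule Inf_lower)
      thus False using * that by (simp add: overshoot_time_def)
    qed
    with 1 show "k \<ge> 1 \<and> walk u k \<ge> b \<and> (\<forall>j\<in>{1..<k}. walk u j < b)" by blast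
  next
    assume *: "k \<ge> 1 \<and> walk u k \<ge> b \<and> (\<forall>j\<in>{1..<k}. walk u j < b)"
    show "overshoot_time b u = enat k"
      unfolding overshoot_time_def
    proof (rule antisym)
      show "Inf ?A \<le> enat k" using * by (intro Inf_lower) auto
      show "enat k \<le> Inf ?A"
      proof (rule Inf_greatest)
        fix x assume "x \<in> ?A"
        then obtain n where n: "x = enat n" "n \<ge> 1" "walk u n \<ge> b" by auto
        with * have "\<not> n < k" by force
        thus "enat k \<le> x" using n by simp
      qed
    qed
  qed
qed

text \<open>In particular, the events in \<^const>\<open>overshoot_coeff\<close> are determined by the first \<open>k\<close> steps.\<close>

lemma overshoot_coeff_altdef:
  assumes "k \<ge> 1" "l \<ge> b"
  shows "overshoot_coeff N c b l k =
           pseudo_prob N c k {u. (\<forall>j\<in>{1..<k}. walk u j < int b) \<and> walk u k = int l}"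
proof -
  have "{u. overshoot_time (int b) u = enat k \<and> overshoot_place (int b) u = int l} =
        {u. overshoot_time (int b) u = enat k \<and> walk u k = int l}"
    by (auto simp: overshoot_place_def)
  also have "\<dots> = {u. (\<forall>j\<in>{1..<k}. walk u j < int b) \<and> walk u k = int l}"
    using assms by (auto simp: overshoot_time_eq_enat_iff)
  finally show ?thesis
    by (simp add: overshoot_coeff_def)
qed

lemma overshoot_coeff_0: "overshoot_coeff N c b l 0 = 0"
  by (simp add: overshoot_coeff_def overshoot_time_eq_enat_iff pseudo_prob_def)


section \<open>Generating functions at one\<close>

text \<open>
  \<open>continued_value_at_1 a L\<close>: the power series \<open>\<Sum>k. a k * z ^ k\<close>, which converges near the
  origin, continues analytically along the segment \<open>[0, 1)\<close>, and the continuation tends to \<open>L\<close> as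
  the point \<open>1\<close> is approached along that segment.
\<close>

definition continued_value_at_1 :: "(nat \<Rightarrow> real) \<Rightarrow> real \<Rightarrow> bool" where
  "continued_value_at_1 a L \<longleftrightarrow>
     (\<exists>D f. open D \<and> connected D \<and> complex_of_real ` {0..<1} \<subseteq> D \<and> f holomorphic_on D \<and>
        (\<forall>\<^sub>F z in nhds 0. (\<lambda>k. complex_of_real (a k) * z ^ k) sums f z) \<and>
        ((\<lambda>t. f (complex_of_real t)) \<longlongrightarrow> complex_of_real L) (at_left 1))"

lemma continued_value_at_1_unique:
  assumes "continued_value_at_1 a L" "continued_value_at_1 a M"
  shows "L = M"
proof -
  let ?S = "complex_of_real ` {0..<1}"
  from assms(1) obtain D f where f: "open D" "?S \<subseteq> D" "f holomorphic_on D"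
    "\<forall>\<^sub>F z in nhds 0. (\<lambda>k. complex_of_real (a k) * z ^ k) sums f z"
    "((\<lambda>t. f (complex_of_real t)) \<longlongrightarrow> complex_of_real L) (at_left 1)"
    unfolding continued_value_at_1_def by blast
  from assms(2) obtain E g where g: "open E" "?S \<subseteq> E" "g holomorphic_on E"
    "\<forall>\<^sub>F z in nhds 0. (\<lambda>k. complex_of_real (a k) * z ^ k) sums g z"
    "((\<lambda>t. g (complex_of_real t)) \<longlongrightarrow> complex_of_real M) (at_left 1)"
    unfolding continued_value_at_1_def by blast
  define C where "C = connected_component_set (D \<inter> E) 0"
  have 0: "0 \<in> ?S" by (auto simp: image_iff intro!: bexI[of _ 0])
  have C: "open C" "connected C" "C \<subseteq> D \<inter> E"
    using f(1) g(1) by (auto simp: C_def open_connected_component connected_component_subset open_Int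
        dest: connected_component_in)
  have "connected ?S" by (intro connected_continuous_image continuous_intros) auto
  hence S: "?S \<subseteq> C"
    unfolding C_def using 0 f(2) g(2) by (intro connected_component_maximal) auto
  have "\<forall>\<^sub>F z in nhds 0. f z = g z"
    using f(4) g(4) by eventually_elim (rule sums_unique2)
  then obtain U where U: "open U" "0 \<in> U" "\<And>z. z \<in> U \<Longrightarrow> f z = g z"
    unfolding eventually_nhds by blast
  have eq: "f z = g z" if "z \<in> C" for z
  proof (rule analytic_continuation_open[of "U \<inter> C" C f g])
    show "open (U \<inter> C)" "open C" "connected C" "U \<inter> C \<subseteq> C" "U \<inter> C \<noteq> {}" "z \<in> C"
      using U(1,2) C(1,2) subsetD[OF S 0] that by auto
    show "f holomorphic_on C" "g holomorphic_on C"
      using f(3) g(3) C(3) by (auto intro: holomorphic_on_subset)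
  qed (use U in auto)
  have "\<forall>\<^sub>F t in at_left (1::real). t \<in> {0<..<1}"
    by (rule eventually_at_leftI[of 0]) auto
  hence "\<forall>\<^sub>F t in at_left 1. f (complex_of_real t) = g (complex_of_real t)"
    by eventually_elim (use S in \<open>auto intro!: eq\<close>)
  from tendsto_cong[OF this] f(5)
  have "((\<lambda>t. g (complex_of_real t)) \<longlongrightarrow> complex_of_real L) (at_left 1)" by blast
  with g(5) have "complex_of_real L = complex_of_real M"
    by (intro tendsto_unique[of "at_left (1::real)"]) auto
  thus ?thesis by simp
qed

text \<open>
  \<open>overshoot_prob N c b l\<close> is the pseudo-probability that the walk overshoots \<open>b\<close> in finite time and
  lands on \<open>l\<close>, i.e. the generating function of \<^const>\<open>overshoot_coeff\<close> evaluated at \<open>1\<close>: the sum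
  of the series if it converges. The term \<open>k = 0\<close> vanishes. For \<open>c > 1 / 2 ^ (2 * N - 1)\<close> the
  generating function may have a singularity inside the unit disc (for \<open>N = 1\<close>, \<open>b = l = 1\<close> there is
  one at \<open>1 / (1 - 4 * c)\<close>), so that the series at \<open>1\<close> diverges; the value is then that of the
  continued function. When the series converges, both values agree by Abel's limit theorem.
\<close>

definition overshoot_prob :: "nat \<Rightarrow> real \<Rightarrow> nat \<Rightarrow> nat \<Rightarrow> real" where
  "overshoot_prob N c b l =
     (if summable (overshoot_coeff N c b l) then (\<Sum>k. overshoot_coeff N c b l k)
      else (THE L. continued_value_at_1 (overshoot_coeff N c b l) L))"

definition finite_overshoot_prob :: "nat \<Rightarrow> real \<Rightarrow> nat \<Rightarrow> real" where
  "finite_overshoot_prob N c b = (\<Sum>l=b..b + N - 1. overshoot_prob N c b l)"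

end

theory Submission
  imports Defs "HOL-Library.Groups_Big_Fun"
begin

text \<open>
  Write \<open>T\<close> for the one-step operator of the walk killed on reaching \<open>{b, b + 1, \<dots>}\<close>, acting on
  finitely supported functions on \<open>{\<dots>, b - 2, b - 1}\<close>. The step weights are those of
  \<open>1 - c D\<^sup>* \<^sup>N D\<^sup>N\<close>, where \<open>D\<close> is the forward difference and \<open>D\<^sup>*\<close> its adjoint, so \<open>T\<close> is symmetric
  and \<open>\<langle>(1 - T) u, u\<rangle> = c \<parallel>D\<^sup>N u\<parallel>\<^sup>2\<close>. Since \<open>u\<close> vanishes from \<open>b\<close> on, summing \<open>N\<close> times bounds
  \<open>u x\<close> by this energy. If \<open>c \<le> 2 / 4 ^ N\<close>, the form of \<open>1 + T\<close> dominates \<open>\<parallel>u(\<cdot> + 1) + u\<parallel>\<^sup>2 / 2\<close>, hence also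
  \<open>u x\<close>. These two bounds, applied to the partial sums \<open>\<Sum>k<n. (\<plusminus>T)\<^sup>k \<delta>\<^sub>x\<close>, force
  \<open>\<Sum>m. \<parallel>T\<^sup>m \<delta>\<^sub>x\<parallel>\<^sup>2 < \<infinity>\<close> (\<open>summable_ip_killed_law\<close>), and by symmetry of \<open>T\<close> the kernels
  \<open>(T\<^sup>k \<delta>\<^sub>x) y\<close> are absolutely summable in \<open>k\<close> (\<open>summable_killed_law\<close>). A landing probability is a
  finite combination of such kernels, so its series converges.

  For the values in that range of \<open>c\<close>, let \<open>G = \<Sum>k. T\<^sup>k \<delta>\<^sub>0\<close> be the Green function. Its energy is finite,
  so \<open>D\<^sup>N G\<close> is square summable; far to the left it is also annihilated by \<open>D\<^sup>N\<close>, so it vanishes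
  there. Thus \<open>D\<^sup>N G\<close> has finite support, and summation by parts against a function \<open>q\<close> with
  \<open>D\<^sup>N q = 0\<close> gives the optional stopping identity \<open>(\<Sum>l. P(S\<^sub>b = l) q(l)) = q(0)\<close>
  (\<open>optional_stopping\<close>). All polynomials of degree below \<open>N\<close> qualify: the constant \<open>1\<close> yields total
  mass one, and the Lagrange polynomials for the \<open>N\<close> nodes \<open>b, \<dots>, b + N - 1\<close> yield the individual
  weights.

  Changing \<open>c\<close> only makes the walk lazier or less lazy: \<open>T\<close> for the parameter \<open>q c\<close> is
  \<open>(1 - q) + q T\<close> for the parameter \<open>c\<close>. On generating functions this is the substitution
  \<open>z \<mapsto> q z / (1 - (1 - q) z)\<close> (\<open>overshoot_coeff_rescale\<close>), which fixes \<open>1\<close> and maps \<open>[0, 1)\<close> into itself.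
  Therefore the generating function for an arbitrary \<open>c\<close> continues along \<open>[0, 1)\<close>, with the same limit
  at \<open>1\<close> as for the critical \<open>c = 2 / 4 ^ N\<close>. If the series itself converges, Abel's theorem identifies
  its sum with that limit.
\<close>

(* An unbounded sum sign always denotes a series; finitely supported sums are written Sum_any. *)
no_syntax
  "_Sum_any" :: "pttrn \<Rightarrow> 'a \<Rightarrow> 'a::comm_monoid_add"
    (\<open>(\<open>indent=2 notation=\<open>binder \<Sum>\<close>\<close>\<Sum>_. _)\<close> [0, 10] 10)

section \<open>Difference operators and the step operator\<close>

definition fdiff :: "(int \<Rightarrow> real) \<Rightarrow> int \<Rightarrow> real" where
  "fdiff u x = u (x + 1) - u x"

definition bdiff :: "(int \<Rightarrow> real) \<Rightarrow> int \<Rightarrow> real" where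
  "bdiff u x = u (x - 1) - u x"

lemma funpow_fdiff_binomial:
  "(fdiff ^^ n) u x = (\<Sum>m\<le>n. (-1) ^ (n - m) * real (n choose m) * u (x + int m))"
proof (induction n arbitrary: x)
  case (Suc n)
  let ?f = "\<lambda>n m. (-1) ^ (n - m) * real (n choose m)"
  have "(\<Sum>m\<le>Suc n. ?f (Suc n) m * u (x + int m))
        = ?f (Suc n) 0 * u x + (\<Sum>m\<le>n. ?f (Suc n) (Suc m) * u (x + int (Suc m)))"
    by (subst sum.atMost_Suc_shift) simp
  also have "(\<Sum>m\<le>n. ?f (Suc n) (Suc m) * u (x + int (Suc m)))
        = (\<Sum>m\<le>n. ?f n m * u (x + 1 + int m))
          + (\<Sum>m\<le>n. (-1) ^ (n - m) * real (n choose Suc m) * u (x + int (Suc m)))"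
    by (simp add: sum.distrib [symmetric] algebra_simps)
  also have "(\<Sum>m\<le>n. (-1) ^ (n - m) * real (n choose Suc m) * u (x + int (Suc m)))
        = - (\<Sum>m<n. ?f n (Suc m) * u (x + int (Suc m)))"
    unfolding sum_negf [symmetric]
    by (rule sum.mono_neutral_cong_right) (auto simp: Suc_diff_Suc [symmetric])
  also have "?f (Suc n) 0 * u x + ((\<Sum>m\<le>n. ?f n m * u (x + 1 + int m))
        + - (\<Sum>m<n. ?f n (Suc m) * u (x + int (Suc m))))
        = (\<Sum>m\<le>n. ?f n m * u (x + 1 + int m)) - (\<Sum>m\<le>n. ?f n m * u (x + int m))"
    by (simp add: sum.lessThan_Suc_shift lessThan_Suc_atMost [symmetric] del: sum.lessThan_Suc)
  finally have eq: "(\<Sum>m\<le>Suc n. ?f (Suc n) m * u (x + int m))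
      = (\<Sum>m\<le>n. ?f n m * u (x + 1 + int m)) - (\<Sum>m\<le>n. ?f n m * u (x + int m))" .
  show ?case
    by (simp only: eq funpow.simps o_apply fdiff_def [of "(fdiff ^^ n) u"] Suc.IH)
qed auto

lemma funpow_bdiff_eq_fdiff: "(bdiff ^^ n) u x = (-1) ^ n * (fdiff ^^ n) u (x - int n)"
proof (induction n arbitrary: x)
  case (Suc n)
  show ?case
    by (simp add: bdiff_def [of "(bdiff ^^ n) u"] fdiff_def [of "(fdiff ^^ n) u"] Suc.IH algebra_simps)
qed auto

lemma funpow_fdiff_sum:
  "(fdiff ^^ n) (\<lambda>x. \<Sum>k\<in>A. w k * f k x) y = (\<Sum>k\<in>A. w k * (fdiff ^^ n) (f k) y)"
  by (simp add: funpow_fdiff_binomial sum_distrib_left algebra_simps)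
     (subst sum.swap, simp add: algebra_simps)

lemma funpow_fdiff_sums:
  assumes "\<And>x. (\<lambda>k. f k x) sums F x"
  shows "(\<lambda>k. (fdiff ^^ n) (f k) x) sums (fdiff ^^ n) F x"
  unfolding funpow_fdiff_binomial by (intro sums_sum sums_mult assms)

definition step_op :: "nat \<Rightarrow> real \<Rightarrow> (int \<Rightarrow> real) \<Rightarrow> int \<Rightarrow> real" where
  "step_op N c u x = (\<Sum>j=-int N..int N. step_weight N c j * u (x - j))"

text \<open>
  The weights are the coefficients of \<open>1 - c (-1)\<^sup>N (1 - \<zeta>)\<^sup>2\<^sup>N / \<zeta>\<^sup>N\<close>, and
  \<open>(-1)\<^sup>N (1 - \<zeta>)\<^sup>2\<^sup>N / \<zeta>\<^sup>N\<close> is the symbol of \<open>bdiff ^^ N \<circ> fdiff ^^ N\<close>. This factorisation is what makes the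
  walk symmetric and its Dirichlet form a sum of squares.
\<close>

lemma step_op_eq: "step_op N c u x = u x - c * (bdiff ^^ N) ((fdiff ^^ N) u) x"
proof -
  have sgn: "(-1::real) powi (int N - int m - 1) = - ((-1) ^ N * (-1) ^ m)" for m
    by (cases "even N"; cases "even m") (auto simp: power_int_minus_left)
  have bin: "2 * N choose nat (int N - int m + int N) = 2 * N choose m" if "m \<le> 2 * N" for m
  proof -
    have "nat (int N - int m + int N) = 2 * N - m" using that by linarith
    thus ?thesis using binomial_symmetric [OF that] by simp
  qed
  have "(\<Sum>j=-int N..int N. (-1) powi (j - 1) * c * real (2 * N choose nat (j + int N)) * u (x - j))
      = (\<Sum>m\<le>2 * N. - ((-1) ^ N * (-1) ^ m) * c * real (2 * N choose m) * u (x - int N + int m))"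
  proof (rule sym, rule sum.reindex_bij_witness [of _ "\<lambda>j. nat (int N - j)" "\<lambda>m. int N - int m"])
    fix m assume "m \<in> {..2 * N}"
    hence m: "m \<le> 2 * N" by simp
    have "x - (int N - int m) = x - int N + int m" by simp
    thus "(-1) powi (int N - int m - 1) * c * real (2 * N choose nat (int N - int m + int N))
            * u (x - (int N - int m))
          = - ((-1) ^ N * (-1) ^ m) * c * real (2 * N choose m) * u (x - int N + int m)"
      by (simp only: sgn bin [OF m])
  qed auto
  also have "\<dots> = - c * (bdiff ^^ N) ((fdiff ^^ N) u) x"
  proof -
    have "(bdiff ^^ N) ((fdiff ^^ N) u) x = (-1) ^ N * (fdiff ^^ (2 * N)) u (x - int N)"
      by (simp add: funpow_bdiff_eq_fdiff mult_2 funpow_add)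
    also have "\<dots> = (\<Sum>m\<le>2 * N. (-1) ^ N * ((-1) ^ m * real (2 * N choose m) * u (x - int N + int m)))"
      unfolding funpow_fdiff_binomial sum_distrib_left
      by (intro sum.cong) (auto simp: minus_one_power_iff)
    finally show ?thesis by (simp add: sum_distrib_left sum_negf algebra_simps)
  qed
  finally have *: "(\<Sum>j=-int N..int N. (-1) powi (j - 1) * c * real (2 * N choose nat (j + int N)) * u (x - j))
      = - c * (bdiff ^^ N) ((fdiff ^^ N) u) x" .
  have "(\<Sum>j=-int N..int N. (if j = 0 then 1 else 0) * u (x - j))
      = (\<Sum>j=-int N..int N. if j = 0 then u x else 0)"
    by (intro sum.cong) auto
  hence "(\<Sum>j=-int N..int N. (if j = 0 then 1 else 0) * u (x - j)) = u x"
    by simp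
  with * show ?thesis
    by (simp add: step_op_def step_weight_def distrib_right sum.distrib)
qed

lemma step_op_sum:
  "step_op N c (\<lambda>x. \<Sum>k\<in>A. w k * f k x) y = (\<Sum>k\<in>A. w k * step_op N c (f k) y)"
  unfolding step_op_def
  by (simp add: sum_distrib_left) (subst sum.swap, simp add: algebra_simps)

lemma step_op_sums:
  assumes "\<And>x. (\<lambda>k. f k x) sums F x"
  shows "(\<lambda>k. step_op N c (f k) x) sums step_op N c F x"
  unfolding step_op_def by (intro sums_sum sums_mult assms)

definition killed :: "nat \<Rightarrow> real \<Rightarrow> int \<Rightarrow> (int \<Rightarrow> real) \<Rightarrow> int \<Rightarrow> real" where
  "killed N c b u x = (if x < b then step_op N c u x else 0)"

lemma killed_sum:
  "killed N c b (\<lambda>x. \<Sum>k\<in>A. w k * f k x) = (\<lambda>x. \<Sum>k\<in>A. w k * killed N c b (f k) x)"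
  by (auto simp: killed_def step_op_sum)

section \<open>Summation by parts for finitely supported functions\<close>

definition ip :: "(int \<Rightarrow> real) \<Rightarrow> (int \<Rightarrow> real) \<Rightarrow> real" where
  "ip u v = Sum_any (\<lambda>x. u x * v x)"

definition fin_supp :: "(int \<Rightarrow> real) \<Rightarrow> bool" where
  "fin_supp u \<longleftrightarrow> finite {x. u x \<noteq> 0}"

lemma ip_commute: "ip u v = ip v u"
  by (simp add: ip_def mult.commute)

lemma fin_supp_subset:
  assumes "fin_supp u" "\<And>x. u x = 0 \<Longrightarrow> v x = 0" shows "fin_supp v"
  using assms unfolding fin_supp_def by (metis (mono_tags, lifting) Collect_mono finite_subset)

lemma fin_supp_mult [intro]: "fin_supp u \<Longrightarrow> fin_supp (\<lambda>x. u x * v x)"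
  by (erule fin_supp_subset) auto

lemma fin_supp_add [intro]:
  assumes "fin_supp u" "fin_supp v" shows "fin_supp (\<lambda>x. u x + v x)"
  using assms unfolding fin_supp_def
  by (rule finite_subset [rotated, OF finite_UnI]) auto

lemma fin_supp_cmult [intro]: "fin_supp u \<Longrightarrow> fin_supp (\<lambda>x. a * u x)"
  by (erule fin_supp_subset) auto

lemma fin_supp_diff [intro]:
  assumes "fin_supp u" "fin_supp v" shows "fin_supp (\<lambda>x. u x - v x)"
  using fin_supp_add [OF assms(1) fin_supp_cmult [OF assms(2), of "-1"]] by simp

lemma fin_supp_shift: "fin_supp u \<Longrightarrow> fin_supp (\<lambda>x. u (x + a))"
  unfolding fin_supp_def
  by (drule finite_vimageI [of _ "\<lambda>x. x + a"]) (auto simp: inj_on_def vimage_def)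

lemma fin_supp_sum [intro]:
  assumes "finite A" "\<And>k. k \<in> A \<Longrightarrow> fin_supp (f k)" shows "fin_supp (\<lambda>x. \<Sum>k\<in>A. f k x)"
  using assms by (induction A rule: finite_induct) (auto simp: fin_supp_def [of "\<lambda>x. 0"])

lemma fin_supp_fdiff [intro]: "fin_supp u \<Longrightarrow> fin_supp (fdiff u)"
  unfolding fdiff_def [abs_def] by (intro fin_supp_diff fin_supp_shift)

lemma fin_supp_bdiff [intro]: "fin_supp u \<Longrightarrow> fin_supp (bdiff u)"
  unfolding bdiff_def [abs_def] using fin_supp_shift [of u "-1"] by (intro fin_supp_diff) auto

lemma fin_supp_funpow_fdiff [intro]: "fin_supp u \<Longrightarrow> fin_supp ((fdiff ^^ n) u)"
  by (induction n) auto

lemma fin_supp_funpow_bdiff [intro]: "fin_supp u \<Longrightarrow> fin_supp ((bdiff ^^ n) u)"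
  by (induction n) auto

lemma fin_supp_step_op [intro]: "fin_supp u \<Longrightarrow> fin_supp (step_op N c u)"
  unfolding step_op_eq [abs_def] by (intro fin_supp_diff fin_supp_cmult fin_supp_funpow_fdiff fin_supp_funpow_bdiff)

lemma fin_supp_killed [intro]: "fin_supp u \<Longrightarrow> fin_supp (killed N c b u)"
  by (drule fin_supp_step_op [of _ N c], erule fin_supp_subset) (simp add: killed_def)

lemma Sum_any_add:
  assumes "fin_supp u" "fin_supp v"
  shows "Sum_any (\<lambda>x. u x + v x) = Sum_any (\<lambda>x. u x) + Sum_any (\<lambda>x. v x)"
  using assms unfolding fin_supp_def by (rule Sum_any.distrib)

lemma Sum_any_cmult: "fin_supp u \<Longrightarrow> Sum_any (\<lambda>x. a * u x) = a * Sum_any (\<lambda>x. u x)"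
  unfolding fin_supp_def by (simp add: Sum_any_right_distrib)

lemma Sum_any_diff:
  assumes "fin_supp u" "fin_supp v"
  shows "Sum_any (\<lambda>x. u x - v x) = Sum_any (\<lambda>x. u x) - Sum_any (\<lambda>x. v x)"
  using Sum_any_add [OF assms(1) fin_supp_cmult [OF assms(2), of "-1"]]
    Sum_any_cmult [OF assms(2), of "-1"] by simp

lemma Sum_any_shift: "Sum_any (\<lambda>x. u (x + a)) = Sum_any (\<lambda>x::int. u x :: real)"
  by (rule Sum_any.reindex_cong [symmetric, of "\<lambda>x. x + a"])
     (auto intro!: bij_betwI [of _ _ _ "\<lambda>x. x - a"])

lemma ip_diff_left:
  assumes "fin_supp u" "fin_supp v" shows "ip (\<lambda>x. u x - v x) w = ip u w - ip v w"
  unfolding ip_def left_diff_distrib using assms by (intro Sum_any_diff) auto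

lemma ip_add_left:
  assumes "fin_supp u" "fin_supp v" shows "ip (\<lambda>x. u x + v x) w = ip u w + ip v w"
  unfolding ip_def distrib_right using assms by (intro Sum_any_add) auto

lemma ip_cmult_left:
  assumes "fin_supp u" shows "ip (\<lambda>x. a * u x) w = a * ip u w"
  unfolding ip_def mult.assoc using assms by (intro Sum_any_cmult) auto

lemma ip_sum_left:
  assumes "finite A" "\<And>k. k \<in> A \<Longrightarrow> fin_supp (f k)"
  shows "ip (\<lambda>x. \<Sum>k\<in>A. f k x) w = (\<Sum>k\<in>A. ip (f k) w)"
  using assms
proof (induction A rule: finite_induct)
  case (insert a A)
  thus ?case by (simp add: ip_add_left fin_supp_sum)
qed (simp add: ip_def)

lemma ip_bdiff_left:
  assumes "fin_supp u" shows "ip (bdiff u) v = ip u (fdiff v)"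
proof -
  have "ip (bdiff u) v = Sum_any (\<lambda>x. u (x - 1) * v x) - Sum_any (\<lambda>x. u x * v x)"
    unfolding ip_def bdiff_def left_diff_distrib
    using assms fin_supp_shift [of u "-1"] by (intro Sum_any_diff fin_supp_mult) auto
  also have "Sum_any (\<lambda>x. u (x - 1) * v x) = Sum_any (\<lambda>x. u x * v (x + 1))"
    using Sum_any_shift [of "\<lambda>x. u (x - 1) * v x" 1] by simp
  also have "\<dots> - Sum_any (\<lambda>x. u x * v x) = ip u (fdiff v)"
    unfolding ip_def fdiff_def right_diff_distrib
    using assms by (intro Sum_any_diff [symmetric] fin_supp_mult) auto
  finally show ?thesis .
qed

lemma ip_funpow_bdiff_left:
  "fin_supp u \<Longrightarrow> ip ((bdiff ^^ n) u) v = ip u ((fdiff ^^ n) v)"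
proof (induction n arbitrary: v)
  case (Suc n)
  have "ip ((bdiff ^^ Suc n) u) v = ip ((bdiff ^^ n) u) (fdiff v)"
    using Suc.prems by (simp add: ip_bdiff_left fin_supp_funpow_bdiff)
  also have "\<dots> = ip u ((fdiff ^^ n) (fdiff v))"
    using Suc by simp
  finally show ?case
    by (simp add: funpow_Suc_right del: funpow.simps(2))
qed auto

lemma ip_step_op_left:
  assumes "fin_supp u" 
  shows "ip (step_op N c u) v = ip u v - c * ip ((fdiff ^^ N) u) ((fdiff ^^ N) v)"
proof -
  have "ip (step_op N c u) v = ip u v - ip (\<lambda>x. c * (bdiff ^^ N) ((fdiff ^^ N) u) x) v"
    unfolding step_op_eq [abs_def] using assms by (intro ip_diff_left) auto
  also have "ip (\<lambda>x. c * (bdiff ^^ N) ((fdiff ^^ N) u) x) v = c * ip ((bdiff ^^ N) ((fdiff ^^ N) u)) v"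
    using assms by (intro ip_cmult_left) auto
  also have "ip ((bdiff ^^ N) ((fdiff ^^ N) u)) v = ip ((fdiff ^^ N) u) ((fdiff ^^ N) v)"
    using assms by (intro ip_funpow_bdiff_left) auto
  finally show ?thesis .
qed

definition supp_below :: "int \<Rightarrow> (int \<Rightarrow> real) \<Rightarrow> bool" where
  "supp_below b u \<longleftrightarrow> fin_supp u \<and> (\<forall>x\<ge>b. u x = 0)"

text \<open>
  Killing does not change the form on functions vanishing from \<open>b\<close> on, because the mass
  that leaves \<open>{..<b}\<close> is paired with \<open>0\<close>.
\<close>

lemma ip_killed_left:
  assumes "supp_below b u" "supp_below b v"
  shows "ip (killed N c b u) v = ip u v - c * ip ((fdiff ^^ N) u) ((fdiff ^^ N) v)"
proof -
  have "ip (killed N c b u) v = ip (step_op N c u) v"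
    unfolding ip_def using assms(2)
    by (intro Sum_any.cong) (auto simp: killed_def supp_below_def not_less)
  thus ?thesis using assms(1) by (simp add: ip_step_op_left supp_below_def)
qed

lemma ip_killed_symmetric:
  assumes "supp_below b u" "supp_below b v"
  shows "ip (killed N c b u) v = ip u (killed N c b v)"
  unfolding ip_commute [of u "killed N c b v"] ip_killed_left [OF assms]
    ip_killed_left [OF assms(2,1)] ip_commute [of v u]
    ip_commute [of "(fdiff ^^ N) v" "(fdiff ^^ N) u"] ..

lemma supp_below_killed [intro]: "supp_below b u \<Longrightarrow> supp_below b (killed N c b u)"
  by (auto simp: supp_below_def) (auto simp: killed_def)

lemma supp_below_funpow_killed [intro]: "supp_below b u \<Longrightarrow> supp_below b ((killed N c b ^^ n) u)"
  by (induction n) auto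

lemma ip_funpow_killed:
  assumes "supp_below b u" "supp_below b v"
  shows "ip ((killed N c b ^^ (m + n)) u) v = ip ((killed N c b ^^ m) u) ((killed N c b ^^ n) v)"
proof (induction n arbitrary: m)
  case (Suc n)
  have "ip ((killed N c b ^^ (m + Suc n)) u) v = ip ((killed N c b ^^ (Suc m + n)) u) v" by simp
  also have "\<dots> = ip ((killed N c b ^^ Suc m) u) ((killed N c b ^^ n) v)" by (rule Suc)
  also have "\<dots> = ip ((killed N c b ^^ m) u) ((killed N c b ^^ Suc n) v)"
    using assms by (simp add: ip_killed_symmetric supp_below_funpow_killed)
  finally show ?case .
qed auto

section \<open>Energy estimates for the killed walk\<close>

definition fwd_sum :: "(int \<Rightarrow> real) \<Rightarrow> int \<Rightarrow> real" where
  "fwd_sum u x = u (x + 1) + u x"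

lemma fin_supp_fwd_sum [intro]: "fin_supp u \<Longrightarrow> fin_supp (fwd_sum u)"
  unfolding fwd_sum_def [abs_def] by (intro fin_supp_add fin_supp_shift)

lemma power2_le_ip:
  assumes "fin_supp u" shows "(u x)\<^sup>2 \<le> ip u u"
proof -
  have fin: "finite (insert x {y. u y \<noteq> 0})" using assms by (simp add: fin_supp_def)
  have "(u x)\<^sup>2 \<le> (\<Sum>y\<in>insert x {y. u y \<noteq> 0}. u y * u y)"
    using member_le_sum [of x "insert x {y. u y \<noteq> 0}" "\<lambda>y. u y * u y"] fin
    by (simp add: power2_eq_square)
  also have "\<dots> = ip u u"
    unfolding ip_def using fin by (intro Sum_any.expand_superset [symmetric]) auto
  finally show ?thesis .
qed

lemma ip_nonneg: "fin_supp u \<Longrightarrow> 0 \<le> ip u u"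
  using power2_le_ip [of u 0] by (meson order_trans zero_le_power2)

lemma sum_power2_le_ip:
  assumes "fin_supp u" "finite F" shows "(\<Sum>x\<in>F. (u x)\<^sup>2) \<le> ip u u"
proof -
  have fin: "finite (F \<union> {y. u y \<noteq> 0})" using assms by (simp add: fin_supp_def)
  have "(\<Sum>x\<in>F. (u x)\<^sup>2) \<le> (\<Sum>x\<in>F \<union> {y. u y \<noteq> 0}. u x * u x)"
    using fin by (simp add: power2_eq_square, intro sum_mono2) auto
  also have "\<dots> = ip u u"
    unfolding ip_def using fin by (intro Sum_any.expand_superset [symmetric]) auto
  finally show ?thesis .
qed

text \<open>
  The parallelogram identity for the shift: \<open>|e\<^sup>i\<^sup>\<theta> - 1|\<^sup>2 + |e\<^sup>i\<^sup>\<theta> + 1|\<^sup>2 = 4\<close> on the Fourier side.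
\<close>

lemma ip_fdiff_fwd_sum:
  assumes "fin_supp u"
  shows "ip (fdiff u) (fdiff u) + ip (fwd_sum u) (fwd_sum u) = 4 * ip u u"
proof -
  have "ip (fdiff u) (fdiff u) + ip (fwd_sum u) (fwd_sum u)
      = Sum_any (\<lambda>x. fdiff u x * fdiff u x + fwd_sum u x * fwd_sum u x)"
    unfolding ip_def using assms by (intro Sum_any_add [symmetric] fin_supp_mult) auto
  also have "\<dots> = Sum_any (\<lambda>x. 2 * (u (x + 1) * u (x + 1)) + 2 * (u x * u x))"
    by (intro Sum_any.cong) (simp add: fdiff_def fwd_sum_def algebra_simps)
  also have "\<dots> = 2 * Sum_any (\<lambda>x. u (x + 1) * u (x + 1)) + 2 * Sum_any (\<lambda>x. u x * u x)"
    using assms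
    by (subst Sum_any_add) (auto intro!: Sum_any_cmult fin_supp_shift [of "\<lambda>x. u x * u x" 1] arg_cong2 [of _ _ _ _ "(+)"])
  also have "Sum_any (\<lambda>x. u (x + 1) * u (x + 1)) = Sum_any (\<lambda>x. u x * u x)"
    by (rule Sum_any_shift)
  finally show ?thesis by (simp add: ip_def)
qed

lemma ip_funpow_fdiff_le:
  "fin_supp u \<Longrightarrow> ip ((fdiff ^^ n) u) ((fdiff ^^ n) u) \<le> 4 ^ n * ip u u"
proof (induction n)
  case (Suc n)
  have "ip ((fdiff ^^ Suc n) u) ((fdiff ^^ Suc n) u) \<le> 4 * ip ((fdiff ^^ n) u) ((fdiff ^^ n) u)"
    using ip_fdiff_fwd_sum [of "(fdiff ^^ n) u"] ip_nonneg [of "fwd_sum ((fdiff ^^ n) u)"] Suc.prems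
    by (auto simp: fin_supp_funpow_fdiff fin_supp_fwd_sum)
  with Suc show ?case by simp
qed auto

text \<open>
  Telescoping from the boundary point \<open>b\<close> down to \<open>y\<close>. It serves for differences and, up to
  alternating signs, for sums of neighbouring values.
\<close>

lemma abs_le_of_successive:
  fixes u :: "int \<Rightarrow> real"
  assumes "\<And>y. y \<ge> b \<Longrightarrow> u y = 0"
    and "\<And>y. y \<ge> x \<Longrightarrow> \<bar>u y\<bar> \<le> \<bar>u (y + 1)\<bar> + e"
    and "e \<ge> 0" "x \<le> b" "y \<ge> x"
  shows "\<bar>u y\<bar> \<le> real_of_int (b - x) * e"
proof -
  have *: "x \<le> y \<Longrightarrow> \<bar>u y\<bar> \<le> real_of_int (b - y) * e" if "y \<le> b" for y
    using that
  proof (induction y rule: int_le_induct)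
    case base
    thus ?case using assms(1) [of b] by simp
  next
    case (step y)
    have "\<bar>u (y - 1)\<bar> \<le> \<bar>u y\<bar> + e" using assms(2) [of "y - 1"] step.prems by simp
    also have "\<dots> \<le> real_of_int (b - y) * e + e" using step by simp
    finally show ?case by (simp add: algebra_simps)
  qed
  show ?thesis
  proof (cases "y \<le> b")
    case True
    have "real_of_int (b - y) * e \<le> real_of_int (b - x) * e"
      using assms by (intro mult_right_mono) auto
    with * [OF True assms(5)] show ?thesis by linarith
  next
    case False
    thus ?thesis using assms by simp
  qed
qed

lemma abs_le_of_funpow_fdiff:
  assumes "\<And>y. y \<ge> b \<Longrightarrow> u y = 0"
    and "\<And>y. y \<ge> x \<Longrightarrow> \<bar>(fdiff ^^ n) u y\<bar> \<le> e"
    and "e \<ge> 0" "x \<le> b" "y \<ge> x"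
  shows "\<bar>u y\<bar> \<le> real_of_int (b - x) ^ n * e"
  using assms
proof (induction n arbitrary: u y)
  case (Suc n)
  have "\<bar>fdiff u y\<bar> \<le> real_of_int (b - x) ^ n * e" if "y \<ge> x" for y
  proof (rule Suc.IH)
    show "fdiff u y = 0" if "y \<ge> b" for y using Suc.prems(1) that by (simp add: fdiff_def)
    show "\<bar>(fdiff ^^ n) (fdiff u) y\<bar> \<le> e" if "y \<ge> x" for y
      using Suc.prems(2) [OF that] by (simp add: funpow_Suc_right del: funpow.simps(2))
  qed (use Suc.prems that in auto)
  hence "\<bar>u y\<bar> \<le> \<bar>u (y + 1)\<bar> + real_of_int (b - x) ^ n * e" if "y \<ge> x" for y
    using that by (fastforce simp: fdiff_def)
  hence "\<bar>u y\<bar> \<le> real_of_int (b - x) * (real_of_int (b - x) ^ n * e)"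
    using Suc.prems by (intro abs_le_of_successive [of b u x]) auto
  thus ?case by (simp add: mult.assoc)
qed auto

text \<open>
  Coercivity of \<open>1 - T\<close>: its form is \<open>c\<close> times the squared norm of the \<open>N\<close>-th difference,
  and \<open>u x\<close> is recovered from that difference by \<open>N\<close> finite summations starting at \<open>b\<close>.
\<close>

lemma power2_le_of_energy_minus:
  assumes "supp_below b u" "x < b" "c > 0"
  shows "(u x)\<^sup>2 \<le> real_of_int (b - x) ^ (2 * N) / c * ip (\<lambda>y. u y - killed N c b u y) u"
proof -
  let ?D = "(fdiff ^^ N) u"
  have fin: "fin_supp u" "fin_supp ?D" using assms by (auto simp: supp_below_def)
  define e where "e = sqrt (ip ?D ?D)"
  have e: "e \<ge> 0" "e\<^sup>2 = ip ?D ?D" using fin by (auto simp: e_def ip_nonneg)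
  have "\<bar>?D y\<bar> \<le> e" for y
    unfolding e_def using power2_le_ip [OF fin(2), of y] by (intro real_le_rsqrt) auto
  hence "\<bar>u x\<bar> \<le> real_of_int (b - x) ^ N * e"
    using assms e by (intro abs_le_of_funpow_fdiff [of b u x N]) (auto simp: supp_below_def)
  hence "\<bar>u x\<bar>\<^sup>2 \<le> (real_of_int (b - x) ^ N * e)\<^sup>2" by (intro power_mono) auto
  hence "(u x)\<^sup>2 \<le> real_of_int (b - x) ^ (2 * N) * ip ?D ?D"
    by (simp add: power_mult_distrib e(2) power_mult [symmetric] mult.commute [of N 2])
  also have "\<dots> = real_of_int (b - x) ^ (2 * N) / c * (c * ip ?D ?D)"
    using assms by simp
  also have "c * ip ?D ?D = ip (\<lambda>y. u y - killed N c b u y) u"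
    using assms fin by (subst ip_diff_left) (auto simp: ip_killed_left)
  finally show ?thesis .
qed

text \<open>
  Coercivity of \<open>1 + T\<close>. The symbol \<open>2 - c (2 - 2 cos \<theta>)\<^sup>N\<close> is nonnegative exactly for
  \<open>c \<le> 2 / 4 ^ N\<close>; at the critical value it still dominates half the symbol \<open>2 + 2 cos \<theta>\<close> of the
  squared norm of \<open>fwd_sum u\<close>, as one difference out of \<open>N\<close> is kept and the others are estimated
  by \<open>4\<close> each.
\<close>

lemma power2_le_of_energy_plus:
  assumes "supp_below b u" "x < b" "0 \<le> c" "c \<le> 2 / 4 ^ N" "N \<ge> 1"
  shows "(u x)\<^sup>2 \<le> 2 * (real_of_int (b - x))\<^sup>2 * ip (\<lambda>y. u y + killed N c b u y) u"
proof -
  let ?D = "(fdiff ^^ N) u" and ?S = "fwd_sum u"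
  have fin: "fin_supp u" "fin_supp ?D" "fin_supp ?S" "fin_supp (fdiff u)" using assms by (auto simp: supp_below_def)
  define e where "e = sqrt (ip ?S ?S)"
  have e: "e \<ge> 0" "e\<^sup>2 = ip ?S ?S" using fin by (auto simp: e_def ip_nonneg)
  have "\<bar>?S y\<bar> \<le> e" for y
    unfolding e_def using power2_le_ip [OF fin(3), of y] by (intro real_le_rsqrt) auto
  hence S: "\<bar>u (y + 1) + u y\<bar> \<le> e" for y
    by (simp add: fwd_sum_def)
  have "\<bar>u y\<bar> \<le> \<bar>u (y + 1)\<bar> + e" for y
    using S [of y] by linarith
  hence "\<bar>u x\<bar> \<le> real_of_int (b - x) * e"
    using assms e by (intro abs_le_of_successive [of b u x]) (auto simp: supp_below_def)
  hence "\<bar>u x\<bar>\<^sup>2 \<le> (real_of_int (b - x) * e)\<^sup>2" by (intro power_mono) auto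
  hence *: "(u x)\<^sup>2 \<le> (real_of_int (b - x))\<^sup>2 * ip ?S ?S"
    by (simp add: power_mult_distrib e(2))
  obtain M where M: "N = Suc M" using assms(5) by (cases N) auto
  have "ip ?D ?D \<le> 4 ^ M * ip (fdiff u) (fdiff u)"
    using ip_funpow_fdiff_le [OF fin(4), of M] by (simp add: M funpow_Suc_right del: funpow.simps(2))
  also have "\<dots> = 4 ^ M * (4 * ip u u - ip ?S ?S)"
    using ip_fdiff_fwd_sum [OF fin(1)] by simp
  finally have "c * ip ?D ?D \<le> 2 / 4 ^ N * (4 ^ M * (4 * ip u u - ip ?S ?S))"
    using assms fin by (intro mult_mono) (auto simp: ip_nonneg)
  also have "\<dots> = 2 * ip u u - ip ?S ?S / 2" by (simp add: M field_simps)
  finally have le: "c * ip ?D ?D \<le> 2 * ip u u - ip ?S ?S / 2" .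
  have "ip (\<lambda>y. u y + killed N c b u y) u = 2 * ip u u - c * ip ?D ?D"
    using assms fin by (subst ip_add_left) (auto simp: ip_killed_left)
  with le have "ip ?S ?S \<le> 2 * ip (\<lambda>y. u y + killed N c b u y) u"
    by linarith
  hence "(real_of_int (b - x))\<^sup>2 * ip ?S ?S
      \<le> (real_of_int (b - x))\<^sup>2 * (2 * ip (\<lambda>y. u y + killed N c b u y) u)"
    by (intro mult_left_mono) auto
  with * show ?thesis by (simp add: algebra_simps)
qed

section \<open>Summability of the killed walk in time\<close>

definition unit_at :: "int \<Rightarrow> int \<Rightarrow> real" where
  "unit_at x y = (if y = x then 1 else 0)"

text \<open>
  The signed mass at each site after \<open>k\<close> steps of a walk started in \<open>x\<close>, counting only
  paths that stay below \<open>b\<close>.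
\<close>

definition killed_law :: "nat \<Rightarrow> real \<Rightarrow> int \<Rightarrow> int \<Rightarrow> nat \<Rightarrow> int \<Rightarrow> real" where
  "killed_law N c b x k = (killed N c b ^^ k) (unit_at x)"

lemma ip_unit_at: "ip (unit_at x) u = u x"
proof -
  have "ip (unit_at x) u = Sum_any (\<lambda>y. if y = x then u y else 0)"
    unfolding ip_def by (intro Sum_any.cong) (simp add: unit_at_def)
  thus ?thesis by simp
qed

lemma supp_below_unit_at: "x < b \<Longrightarrow> supp_below b (unit_at x)"
  by (auto simp: supp_below_def fin_supp_def unit_at_def)

lemma supp_below_killed_law: "x < b \<Longrightarrow> supp_below b (killed_law N c b x k)"
  by (auto simp: killed_law_def intro: supp_below_unit_at)

lemma killed_law_Suc: "killed_law N c b x (Suc k) = killed N c b (killed_law N c b x k)"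
  by (simp add: killed_law_def)

lemma ip_killed_law:
  assumes "x < b" "y < b"
  shows "ip (killed_law N c b x i) (killed_law N c b y j) = killed_law N c b x (i + j) y"
  using ip_funpow_killed [OF assms [THEN supp_below_unit_at], where N = N and c = c and m = i and n = j]
  by (simp add: killed_law_def ip_commute [of _ "unit_at y"] ip_unit_at)

lemma supp_below_sum:
  assumes "finite A" "\<And>k. k \<in> A \<Longrightarrow> supp_below b (f k)"
  shows "supp_below b (\<lambda>y. \<Sum>k\<in>A. w k * f k y)"
  using assms unfolding supp_below_def by (auto intro!: fin_supp_sum fin_supp_cmult)

text \<open>
  With \<open>u = (\<Sum>k<n. \<epsilon>\<^sup>k T\<^sup>k \<delta>\<^sub>x)\<close> one has \<open>(1 - \<epsilon> T) u = \<delta>\<^sub>x - \<epsilon>\<^sup>n T\<^sup>n \<delta>\<^sub>x\<close>; pairing with \<open>u\<close> and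
  using the symmetry of \<open>T\<close> leaves return weights only.
\<close>

lemma energy_killed_law_partial_sum:
  fixes \<epsilon> c :: real and N :: nat
  assumes x: "x < b"
  defines "S \<equiv> \<lambda>n. \<Sum>k<n. \<epsilon> ^ k * killed_law N c b x k x"
  defines "u \<equiv> \<lambda>n y. \<Sum>k<n. \<epsilon> ^ k * killed_law N c b x k y"
  shows "ip (\<lambda>y. u n y - \<epsilon> * killed N c b (u n) y) (u n) = 2 * S n - S (2 * n)"
proof -
  let ?k = "killed_law N c b x"
  have supp: "supp_below b (?k j)" for j using x by (rule supp_below_killed_law)
  have fin: "fin_supp (?k j)" for j using supp [of j] by (simp add: supp_below_def)
  have ip_u: "ip (?k j) (u n) = (\<Sum>i<n. \<epsilon> ^ i * ?k (j + i) x)" for j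
  proof -
    have "ip (?k j) (u n) = (\<Sum>i<n. ip (\<lambda>y. \<epsilon> ^ i * ?k i y) (?k j))"
      unfolding ip_commute [of "?k j"] u_def using fin by (intro ip_sum_left) auto
    also have "\<dots> = (\<Sum>i<n. \<epsilon> ^ i * ?k (j + i) x)"
      using fin x by (intro sum.cong) (simp_all add: ip_cmult_left ip_killed_law add.commute)
    finally show ?thesis .
  qed
  have "u n y - \<epsilon> * killed N c b (u n) y = ?k 0 y - \<epsilon> ^ n * ?k n y" for y
  proof -
    have "\<epsilon> * killed N c b (u n) y = (\<Sum>k<n. \<epsilon> ^ Suc k * ?k (Suc k) y)"
      by (simp add: u_def killed_sum sum_distrib_left killed_law_Suc mult.assoc)
    hence "u n y - \<epsilon> * killed N c b (u n) y
        = (\<Sum>k<n. \<epsilon> ^ k * ?k k y - \<epsilon> ^ Suc k * ?k (Suc k) y)"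
      by (simp add: u_def sum_subtractf)
    also have "\<dots> = ?k 0 y - \<epsilon> ^ n * ?k n y"
      using sum_lessThan_telescope' [of "\<lambda>k. \<epsilon> ^ k * ?k k y" n] by simp
    finally show ?thesis .
  qed
  hence "ip (\<lambda>y. u n y - \<epsilon> * killed N c b (u n) y) (u n)
      = ip (\<lambda>y. ?k 0 y - \<epsilon> ^ n * ?k n y) (u n)" by presburger
  also have "\<dots> = ip (?k 0) (u n) - \<epsilon> ^ n * ip (?k n) (u n)"
    using fin by (subst ip_diff_left) (auto simp: ip_cmult_left)
  also have "ip (?k 0) (u n) = S n"
    by (simp add: ip_u S_def)
  also have "\<epsilon> ^ n * ip (?k n) (u n) = S (2 * n) - S n"
  proof -
    have "(\<Sum>k<n + m. \<epsilon> ^ k * ?k k x) = S n + (\<Sum>i<m. \<epsilon> ^ (n + i) * ?k (n + i) x)" for m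
      by (induction m) (simp_all add: S_def)
    from this [of n] have "S (2 * n) = S n + (\<Sum>i<n. \<epsilon> ^ (n + i) * ?k (n + i) x)"
      by (simp add: S_def mult_2)
    thus ?thesis by (simp add: ip_u sum_distrib_left power_add mult.assoc)
  qed
  finally show ?thesis by simp
qed

lemma sum_even_nat: "(\<Sum>k<2 * n. (1 + (- 1) ^ k) * f k) = 2 * (\<Sum>m<n. f (2 * m) :: real)"
  by (induction n) (auto simp: algebra_simps)

text \<open>
  Let \<open>S \<epsilon> n = (\<Sum>k<n. \<epsilon>\<^sup>k t\<^sub>k)\<close> with the return weights \<open>t\<^sub>k = (T\<^sup>k \<delta>\<^sub>x) x\<close>. Coercivity of \<open>1 - T\<close> and of
  \<open>1 + T\<close> gives \<open>(S \<epsilon> n)\<^sup>2 \<le> C (2 S \<epsilon> n - S \<epsilon> (2 n))\<close> for both signs. In \<open>E n = S 1 n + S (-1) n\<close> only the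
  even terms \<open>t\<^sub>2\<^sub>m = \<parallel>T\<^sup>m \<delta>\<^sub>x\<parallel>\<^sup>2 \<ge> 0\<close> survive, so adding the two inequalities yields
  \<open>(E n)\<^sup>2 \<le> 4 C E n\<close>, a bound independent of \<open>n\<close>.
\<close>

lemma summable_ip_killed_law:
  assumes x: "x < b" and c: "0 < c" "c \<le> 2 / 4 ^ N" and N: "N \<ge> 1"
  shows "summable (\<lambda>m. ip (killed_law N c b x m) (killed_law N c b x m))"
proof -
  let ?k = "killed_law N c b x"
  have fin: "fin_supp (?k j)" for j using supp_below_killed_law [OF x] by (simp add: supp_below_def)
  define S where "S = (\<lambda>\<epsilon> n. \<Sum>k<n. \<epsilon> ^ k * ?k k x)"
  define C where "C = max (real_of_int (b - x) ^ (2 * N) / c) (2 * (real_of_int (b - x))\<^sup>2)"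
  have C: "C \<ge> 0" by (simp add: C_def max.coboundedI2)
  have energy: "(S \<epsilon> n)\<^sup>2 \<le> C * (2 * S \<epsilon> n - S \<epsilon> (2 * n))" if "\<epsilon> \<in> {1, -1}" for \<epsilon> n
  proof -
    define u where "u = (\<lambda>y. \<Sum>k<n. \<epsilon> ^ k * ?k k y)"
    have u: "supp_below b u"
      unfolding u_def using supp_below_killed_law [OF x] by (intro supp_below_sum) auto
    let ?E = "ip (\<lambda>y. u y - \<epsilon> * killed N c b u y) u"
    have "\<exists>C'. 0 \<le> C' \<and> C' \<le> C \<and> 0 < C' \<and> (u x)\<^sup>2 \<le> C' * ?E"
    proof (cases "\<epsilon> = 1")
      case True
      thus ?thesis using power2_le_of_energy_minus [OF u x c(1), of N] c x
        by (intro exI [of _ "real_of_int (b - x) ^ (2 * N) / c"]) (auto simp: C_def)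
    next
      case False
      thus ?thesis using power2_le_of_energy_plus [OF u x _ c(2) N] c x that
        by (intro exI [of _ "2 * (real_of_int (b - x))\<^sup>2"]) (auto simp: C_def)
    qed
    then obtain C' where C': "C' \<le> C" "0 < C'" "(u x)\<^sup>2 \<le> C' * ?E" by blast
    have "0 \<le> C' * ?E" using C'(3) zero_le_power2 [of "u x"] by linarith
    hence "0 \<le> ?E" using C'(2) by (simp add: zero_le_mult_iff)
    hence "C' * ?E \<le> C * ?E" using C'(1) by (intro mult_right_mono)
    with C'(3) have "(u x)\<^sup>2 \<le> C * ?E" by linarith
    thus ?thesis
      using energy_killed_law_partial_sum [OF x, of \<epsilon> N c n] by (simp add: S_def u_def)
  qed
  define E where "E = (\<lambda>n. \<Sum>k<n. (1 + (-1) ^ k) * ?k k x)"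
  have E: "E n = S 1 n + S (-1) n" for n
    by (simp add: E_def S_def distrib_right sum.distrib)
  have even: "?k (2 * m) x = ip (?k m) (?k m)" for m
    using ip_killed_law [OF x x, of N c m m] by (simp add: mult_2)
  have E_nonneg: "E n \<ge> 0" for n
    unfolding E_def
  proof (intro sum_nonneg)
    fix k :: nat
    show "0 \<le> (1 + (-1) ^ k) * ?k k x"
      by (cases "even k") (auto simp: even ip_nonneg [OF fin] elim!: evenE)
  qed
  have E_le: "E n \<le> 4 * C" for n
  proof -
    have "(E n)\<^sup>2 \<le> 2 * ((S 1 n)\<^sup>2 + (S (-1) n)\<^sup>2)"
      using sum_squares_bound [of "S 1 n" "S (-1) n"] by (simp add: E power2_sum)
    also have "\<dots> \<le> 2 * (C * (2 * S 1 n - S 1 (2 * n)) + C * (2 * S (-1) n - S (-1) (2 * n)))"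
      using energy [of 1 n] energy [of "-1" n] by simp
    also have "\<dots> = 2 * C * (2 * E n - E (2 * n))" by (simp add: E algebra_simps)
    also have "\<dots> \<le> 2 * C * (2 * E n)" using C E_nonneg [of "2 * n"] by (intro mult_left_mono) auto
    finally have "E n * E n \<le> (4 * C) * E n" by (simp add: power2_eq_square)
    thus ?thesis using E_nonneg [of n] C by (cases "E n = 0") (auto simp: mult_le_cancel_right)
  qed
  show ?thesis
  proof (rule summableI_nonneg_bounded)
    show "0 \<le> ip (?k m) (?k m)" for m by (rule ip_nonneg [OF fin])
    show "(\<Sum>m<n. ip (?k m) (?k m)) \<le> 2 * C" for n
      using E_le [of "2 * n"] by (simp add: E_def sum_even_nat even)
  qed
qed

lemma abs_ip_le:
  assumes "fin_supp u" "fin_supp v"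
  shows "\<bar>ip u v\<bar> \<le> (ip u u + ip v v) / 2"
proof -
  let ?A = "{x. u x \<noteq> 0} \<union> {x. v x \<noteq> 0}"
  have fin: "finite ?A" using assms by (simp add: fin_supp_def)
  have ip: "ip u v = (\<Sum>x\<in>?A. u x * v x)" "ip u u = (\<Sum>x\<in>?A. u x * u x)" "ip v v = (\<Sum>x\<in>?A. v x * v x)"
    unfolding ip_def by (rule Sum_any.expand_superset [OF fin], force)+
  have "\<bar>u x * v x\<bar> \<le> (u x * u x + v x * v x) / 2" for x
    using sum_squares_bound [of "\<bar>u x\<bar>" "\<bar>v x\<bar>"] by (simp add: abs_mult power2_eq_square)
  hence "\<bar>ip u v\<bar> \<le> (\<Sum>x\<in>?A. (u x * u x + v x * v x) / 2)"
    unfolding ip by (intro order.trans [OF sum_abs] sum_mono)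
  also have "\<dots> = (ip u u + ip v v) / 2"
    unfolding ip by (simp add: sum.distrib sum_divide_distrib [symmetric])
  finally show ?thesis .
qed

text \<open>
  \<open>(T\<^sup>i\<^sup>+\<^sup>j \<delta>\<^sub>x) y = \<langle>T\<^sup>i \<delta>\<^sub>x, T\<^sup>j \<delta>\<^sub>y\<rangle>\<close> is bounded by half the sum of the squared norms; splitting even and
  odd exponents as equally as possible reduces to the preceding summability.
\<close>

lemma summable_killed_law:
  assumes x: "x < b" and c: "0 < c" "c \<le> 2 / 4 ^ N" and N: "N \<ge> 1"
  shows "summable (\<lambda>k. \<bar>killed_law N c b x k y\<bar>)"
proof (cases "y < b")
  case False
  thus ?thesis using supp_below_killed_law [OF x, of N c] by (simp add: supp_below_def)
next
  case y: True
  define X where "X = (\<lambda>m. ip (killed_law N c b x m) (killed_law N c b x m))"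
  define Y where "Y = (\<lambda>m. ip (killed_law N c b y m) (killed_law N c b y m))"
  have fin: "fin_supp (killed_law N c b z j)" if "z < b" for z j
    using supp_below_killed_law [OF that] by (simp add: supp_below_def)
  have XY: "X m \<ge> 0" "Y m \<ge> 0" for m
    using fin [OF x] fin [OF y] by (auto simp: X_def Y_def ip_nonneg)
  have summ: "summable X" "summable Y"
    unfolding X_def Y_def using x y c N by (auto intro: summable_ip_killed_law)
  have le: "\<bar>killed_law N c b x (i + j) y\<bar> \<le> (X i + Y j) / 2" for i j
    using abs_ip_le [OF fin [OF x] fin [OF y], of i j] ip_killed_law [OF x y]
    by (simp add: X_def Y_def)
  have "summable (\<lambda>m. \<bar>killed_law N c b x (2 * m) y\<bar> + \<bar>killed_law N c b x (2 * m + 1) y\<bar>)"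
  proof (rule summable_comparison_test')
    show "summable (\<lambda>m. (X m + Y m) / 2 + (X (Suc m) + Y m) / 2)"
      using summ by (intro summable_add summable_divide) (auto simp: summable_Suc_iff)
    show "norm (\<bar>killed_law N c b x (2 * m) y\<bar> + \<bar>killed_law N c b x (2 * m + 1) y\<bar>)
        \<le> (X m + Y m) / 2 + (X (Suc m) + Y m) / 2" for m
    proof -
      have "\<bar>killed_law N c b x (2 * m) y\<bar> \<le> (X m + Y m) / 2"
        using le [of m m] by (simp add: mult_2)
      moreover have "\<bar>killed_law N c b x (2 * m + 1) y\<bar> \<le> (X (Suc m) + Y m) / 2"
        using le [of "Suc m" m] by (simp add: mult_2)
      ultimately show ?thesis unfolding real_norm_def by linarith
    qed
  qed
  note bdd = this
  define Z where "Z = (\<Sum>m. \<bar>killed_law N c b x (2 * m) y\<bar> + \<bar>killed_law N c b x (2 * m + 1) y\<bar>)"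
  show ?thesis
  proof (rule summableI_nonneg_bounded)
    fix n
    have "(\<Sum>k<n. \<bar>killed_law N c b x k y\<bar>) \<le> (\<Sum>k<2 * n. \<bar>killed_law N c b x k y\<bar>)"
      by (intro sum_mono2) auto
    also have "\<dots> = (\<Sum>m<n. \<bar>killed_law N c b x (2 * m) y\<bar> + \<bar>killed_law N c b x (2 * m + 1) y\<bar>)"
      by (induction n) auto
    also have "\<dots> \<le> Z"
      unfolding Z_def by (intro sum_le_suminf bdd) auto
    finally show "(\<Sum>k<n. \<bar>killed_law N c b x k y\<bar>) \<le> Z" .
  qed auto
qed

text \<open>
  The bound passes to the Green function pointwise, since it is
  stated on finite sets of sites.
\<close>

lemma energy_killed_law_bounded:
  assumes x: "x < b" and c: "0 < c" "c \<le> 2 / 4 ^ N" and N: "N \<ge> 1"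
  obtains B where "\<And>n F. finite F \<Longrightarrow> (\<Sum>y\<in>F. (\<Sum>k<n. (fdiff ^^ N) (killed_law N c b x k) y)\<^sup>2) \<le> B"
proof
  let ?k = "killed_law N c b x"
  define Z where "Z = (\<Sum>k. \<bar>?k k x\<bar>)"
  fix n and F :: "int set" assume F: "finite F"
  define u where "u = (\<lambda>y. \<Sum>k<n. 1 ^ k * ?k k y)"
  have u: "supp_below b u"
    unfolding u_def using supp_below_killed_law [OF x] by (intro supp_below_sum) auto
  hence fin: "fin_supp u" "fin_supp ((fdiff ^^ N) u)" by (auto simp: supp_below_def)
  have le: "\<bar>\<Sum>k<n. ?k k x\<bar> \<le> Z" for n
    unfolding Z_def
    by (rule order.trans [OF sum_abs], intro sum_le_suminf summable_killed_law assms) auto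
  have "(\<Sum>k<n. (fdiff ^^ N) (?k k) y) = (fdiff ^^ N) u y" for y
    unfolding u_def by (subst funpow_fdiff_sum) simp
  hence "(\<Sum>y\<in>F. (\<Sum>k<n. (fdiff ^^ N) (?k k) y)\<^sup>2) \<le> ip ((fdiff ^^ N) u) ((fdiff ^^ N) u)"
    using sum_power2_le_ip [OF fin(2) F] by simp
  also have "\<dots> = (c * ip ((fdiff ^^ N) u) ((fdiff ^^ N) u)) / c" using c by simp
  also have "c * ip ((fdiff ^^ N) u) ((fdiff ^^ N) u) = ip (\<lambda>y. u y - 1 * killed N c b u y) u"
    using fin u by (subst ip_diff_left) (auto simp: ip_killed_left)
  also have "\<dots> = 2 * (\<Sum>k<n. ?k k x) - (\<Sum>k<2 * n. ?k k x)"
    using energy_killed_law_partial_sum [OF x, of 1 N c n] by (simp add: u_def)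
  also have "\<dots> \<le> 3 * Z"
    using le [of n] le [of "2 * n"] by linarith
  finally show "(\<Sum>y\<in>F. (\<Sum>k<n. (fdiff ^^ N) (?k k) y)\<^sup>2) \<le> 3 * Z / c"
    using c by (simp add: divide_right_mono)
qed

section \<open>Optional stopping\<close>

text \<open>
  On a left half-line, the solutions of \<open>D\<^sup>n g = 0\<close> are polynomials, and the only one tending
  to \<open>0\<close> is \<open>0\<close>.
\<close>

lemma vanishes_left_of_funpow_fdiff:
  assumes "\<And>y. y < a \<Longrightarrow> (fdiff ^^ n) g y = 0"
    and "\<And>y. (\<lambda>m. g (y - int m)) \<longlonglongrightarrow> 0"
    and "y < a"
  shows "g y = 0"
  using assms
proof (induction n arbitrary: g y)
  case (Suc n)
  have *: "fdiff g y = 0" if "y < a" for y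
  proof (rule Suc.IH)
    show "(fdiff ^^ n) (fdiff g) y = 0" if "y < a" for y
      using Suc.prems(1) [OF that] by (simp add: funpow_Suc_right del: funpow.simps(2))
    show "(\<lambda>m. fdiff g (y - int m)) \<longlonglongrightarrow> 0" for y
      using tendsto_diff [OF Suc.prems(2) [of "y + 1"] Suc.prems(2) [of y]]
      by (simp add: fdiff_def algebra_simps)
  qed (fact that)
  have "g (y - int m) = g y" for m
  proof (induction m)
    case (Suc m)
    thus ?case using * [of "y - int (Suc m)"] \<open>y < a\<close> by (simp add: fdiff_def)
  qed auto
  with Suc.prems(2) [of y] have "(\<lambda>m::nat. g y) \<longlonglongrightarrow> 0" by simp
  thus ?case by (simp add: LIMSEQ_const_iff)
qed auto

lemma funpow_fdiff_eq_0_right: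
  "(\<And>y. y \<ge> b \<Longrightarrow> u y = 0) \<Longrightarrow> y \<ge> b \<Longrightarrow> (fdiff ^^ n) u y = 0"
  by (simp add: funpow_fdiff_binomial)

text \<open>
  For the Green function \<open>G\<close> started at \<open>x\<close>, the function \<open>r = G - step_op N c G\<close> is \<open>\<delta>\<^sub>x\<close> below \<open>b\<close> and minus
  the landing weight from \<open>b\<close> on, while \<open>r = c D\<^sup>* \<^sup>N g\<close> with \<open>g = D\<^sup>N G\<close>. Once \<open>g\<close> is known to have finite support,
  \<open>r\<close> is orthogonal to every \<open>q\<close> with \<open>D\<^sup>N q = 0\<close>, although \<open>G\<close> and \<open>q\<close> may have infinite support.
\<close>

lemma optional_stopping:
  assumes x: "x < b" and c: "0 < c" "c \<le> 2 / 4 ^ N" and N: "N \<ge> 1"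
    and q: "\<And>y. (fdiff ^^ N) q y = 0"
  shows "(\<Sum>l\<in>{b..<b + int N}. (\<Sum>k. step_op N c (killed_law N c b x k) l) * q l) = q x"
proof -
  let ?k = "killed_law N c b x"
  define G where "G = (\<lambda>y. (\<Sum>k. ?k k y))"
  define g where "g = (fdiff ^^ N) G"
  have G_sums: "(\<lambda>k. ?k k y) sums G y" for y
    unfolding G_def using summable_killed_law [OF x c N]
    by (intro summable_sums) (rule summable_rabs_cancel)
  have G_right: "G y = 0" if "y \<ge> b" for y
    using supp_below_killed_law [OF x, of N c] that by (simp add: G_def supp_below_def)
  have step_G_sums: "(\<lambda>k. step_op N c (?k k) y) sums step_op N c G y" for y
    by (rule step_op_sums [OF G_sums])
  have g_sums: "(\<lambda>k. (fdiff ^^ N) (?k k) y) sums g y" for y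
    unfolding g_def by (rule funpow_fdiff_sums [OF G_sums])
  have step_G: "step_op N c G y = G y - unit_at x y" if "y < b" for y
  proof -
    have "(\<lambda>k. ?k (Suc k) y) sums (G y - ?k 0 y)"
      using G_sums [of y] sums_Suc_iff [of "\<lambda>k. ?k k y" "G y - ?k 0 y"] by simp
    moreover have "?k (Suc k) y = step_op N c (?k k) y" for k
      using that by (simp add: killed_law_Suc killed_def)
    ultimately show ?thesis
      using step_G_sums [of y] by (simp add: sums_iff killed_law_def)
  qed
  have r: "G y - step_op N c G y = c * (bdiff ^^ N) g y" for y
    by (simp add: step_op_eq g_def)
  obtain B where B: "\<And>n F. finite F \<Longrightarrow> (\<Sum>y\<in>F. (\<Sum>k<n. (fdiff ^^ N) (?k k) y)\<^sup>2) \<le> B"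
    using energy_killed_law_bounded [OF x c N] by blast
  have g_square: "(\<Sum>y\<in>F. (g y)\<^sup>2) \<le> B" if "finite F" for F
  proof (rule LIMSEQ_le_const2)
    show "(\<lambda>n. \<Sum>y\<in>F. (\<Sum>k<n. (fdiff ^^ N) (?k k) y)\<^sup>2) \<longlonglongrightarrow> (\<Sum>y\<in>F. (g y)\<^sup>2)"
      using g_sums by (intro tendsto_intros) (simp add: sums_def)
  qed (use B that in blast)
  \<comment> \<open>Square summability of \<open>g\<close> forces decay towards the left.\<close>
  have g_tendsto: "(\<lambda>m. g (y - int m)) \<longlonglongrightarrow> 0" for y
  proof -
    have "summable (\<lambda>m. (g (y - int m))\<^sup>2)"
    proof (rule summableI_nonneg_bounded)
      fix n
      have "(\<Sum>m<n. (g (y - int m))\<^sup>2) = (\<Sum>z\<in>(\<lambda>m. y - int m) ` {..<n}. (g z)\<^sup>2)"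
        by (subst sum.reindex) (auto simp: inj_on_def)
      also have "\<dots> \<le> B" by (rule g_square) auto
      finally show "(\<Sum>m<n. (g (y - int m))\<^sup>2) \<le> B" .
    qed auto
    hence "(\<lambda>m. (g (y - int m))\<^sup>2) \<longlonglongrightarrow> 0" by (rule summable_LIMSEQ_zero)
    from tendsto_real_sqrt [OF this] show ?thesis by (simp add: tendsto_rabs_zero_iff)
  qed
  have g_left: "g y = 0" if "y < x - int N" for y
  proof (rule vanishes_left_of_funpow_fdiff [OF _ g_tendsto that])
    fix y assume y: "y < x - int N"
    have "c * (bdiff ^^ N) g (y + int N) = 0"
      using step_G [of "y + int N"] r [of "y + int N"] x y by (simp add: unit_at_def)
    thus "(fdiff ^^ N) g y = 0" using c by (simp add: funpow_bdiff_eq_fdiff)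
  qed
  have g_right: "g y = 0" if "y \<ge> b" for y
    unfolding g_def using G_right that by (intro funpow_fdiff_eq_0_right [of b]) auto
  have "{y. g y \<noteq> 0} \<subseteq> {x - int N..<b}"
  proof
    fix y assume "y \<in> {y. g y \<noteq> 0}"
    thus "y \<in> {x - int N..<b}"
      using g_left [of y] g_right [of y] by (cases "y < x - int N"; cases "y \<ge> b") auto
  qed
  hence fin: "fin_supp g"
    unfolding fin_supp_def by (rule finite_subset) simp
  \<comment> \<open>Jumps reach at most \<open>b + N - 1\<close>.\<close>
  have r_right: "step_op N c G y = 0" if "y \<ge> b + int N" for y
    using r [of y] G_right [of y] that funpow_fdiff_eq_0_right [of b g "y - int N" N] g_right
    by (simp add: funpow_bdiff_eq_fdiff)
  have "0 = c * ip g ((fdiff ^^ N) q)"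
    using q by (simp add: ip_def)
  also have "\<dots> = c * ip ((bdiff ^^ N) g) q"
    using fin by (simp add: ip_funpow_bdiff_left)
  also have "\<dots> = ip (\<lambda>y. c * (bdiff ^^ N) g y) q"
    using fin by (subst ip_cmult_left) auto
  also have "\<dots> = Sum_any (\<lambda>y. (G y - step_op N c G y) * q y)"
    by (simp add: ip_def r)
  also have "\<dots> = (\<Sum>y\<in>insert x {b..<b + int N}. (G y - step_op N c G y) * q y)"
  proof (intro Sum_any.expand_superset subsetI)
    fix y assume "y \<in> {y. (G y - step_op N c G y) * q y \<noteq> 0}"
    thus "y \<in> insert x {b..<b + int N}"
      using step_G [of y] r_right [of y] G_right [of y]
      by (cases "y < b"; cases "y \<ge> b + int N") (auto simp: unit_at_def split: if_splits)
  qed auto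
  also have "\<dots> = q x + (\<Sum>l\<in>{b..<b + int N}. (G l - step_op N c G l) * q l)"
    using x by (simp add: step_G unit_at_def)
  also have "(\<Sum>l\<in>{b..<b + int N}. (G l - step_op N c G l) * q l)
      = - (\<Sum>l\<in>{b..<b + int N}. step_op N c G l * q l)"
    unfolding sum_negf [symmetric] by (intro sum.cong) (auto simp: G_right)
  finally have "(\<Sum>l\<in>{b..<b + int N}. step_op N c G l * q l) = q x" by simp
  thus ?thesis using step_G_sums by (simp add: sums_iff)
qed

lemma summable_step_op_killed_law:
  assumes "x < b" "0 < c" "c \<le> 2 / 4 ^ N" "N \<ge> 1"
  shows "summable (\<lambda>k. \<bar>step_op N c (killed_law N c b x k) l\<bar>)"
proof (rule summable_comparison_test')
  show "summable (\<lambda>k. \<Sum>j=-int N..int N. \<bar>step_weight N c j\<bar> * \<bar>killed_law N c b x k (l - j)\<bar>)"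
    using assms by (intro summable_sum summable_mult summable_killed_law)
  show "norm \<bar>step_op N c (killed_law N c b x k) l\<bar>
      \<le> (\<Sum>j=-int N..int N. \<bar>step_weight N c j\<bar> * \<bar>killed_law N c b x k (l - j)\<bar>)" for k
    unfolding step_op_def real_norm_def abs_abs
    by (rule order.trans [OF sum_abs]) (simp add: abs_mult)
qed

section \<open>Landing weights from Lagrange polynomials\<close>

text \<open>
  Each difference lowers the degree by at least one.
\<close>

lemma funpow_fdiff_poly:
  fixes p :: "real poly"
  assumes "p = 0 \<or> degree p < n"
  shows "(fdiff ^^ n) (\<lambda>x. poly p (of_int x)) y = 0"
  using assms
proof (induction n arbitrary: p)
  case (Suc n)
  define r where "r = pcompose p [:1, 1:] - p"
  have "r = 0 \<or> degree r < n"
  proof (cases "degree p = 0")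
    case True
    then obtain a where "p = [:a:]" by (metis degree_eq_zeroE)
    thus ?thesis by (simp add: r_def)
  next
    case False
    have "degree r < degree p \<or> r = 0"
    proof (cases "r = 0")
      case False
      have "degree (pcompose p [:1, 1:]) = degree p" by (simp add: degree_pcompose)
      moreover from this have "coeff (pcompose p [:1, 1:]) (degree p) = lead_coeff p"
        using lead_coeff_comp [of "[:1, 1:] :: real poly" p] by simp
      ultimately have "degree r < degree p"
        using False unfolding r_def
        by (intro degree_less_if_less_eqI) (auto intro: degree_diff_le)
      thus ?thesis ..
    qed auto
    with Suc.prems False show ?thesis by auto
  qed
  moreover have "fdiff (\<lambda>x. poly p (of_int x)) = (\<lambda>x. poly r (of_int x))"
    by (auto simp: fdiff_def r_def poly_pcompose add.commute)
  ultimately show ?case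
    using Suc.IH [of r] by (simp add: funpow_Suc_right del: funpow.simps(2))
qed auto

text \<open>
  The equation says that \<open>L\<close> is the Lagrange basis polynomial of node \<open>l\<close> evaluated at \<open>0\<close>; both
  products are factorials up to sign.
\<close>

lemma landing_value:
  fixes b l N :: nat
  assumes l: "l \<in> {b..<b + N}" and b: "b \<ge> 1"
    and L: "L * (\<Prod>m\<in>{b..<b + N} - {l}. real l - real m) = (\<Prod>m\<in>{b..<b + N} - {l}. - real m)"
  shows "L = (-1) ^ (b + l) * (real b / real l) * real ((N - 1) choose (l - b)) *
              real ((b + N - 1) choose b)"
proof -
  define i where "i = l - b"
  define j where "j = b + N - 1 - l"
  have N: "N = i + j + 1" and l_eq: "l = b + i" using l by (auto simp: i_def j_def)
  have split: "{b..<b + N} - {l} = {b..<b + i} \<union> {b + i + 1..<b + i + 1 + j}"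
    by (auto simp: N l_eq)
  have prod_fact: "(\<Prod>m\<in>{a..<a + n}. real m) * fact (a - 1) = fact (a + n - 1)" if "a \<ge> 1" for a n
    using that by (induction n) (auto simp: fact_reduce algebra_simps)
  have p1: "(\<Prod>m\<in>{b..<b + i}. real (b + i) - real m) = fact i"
  proof (induction i)
    case (Suc i)
    have "(\<Prod>m\<in>{b..<b + Suc i}. real (b + Suc i) - real m)
        = (\<Prod>m\<in>{b..<b + i}. real (b + i) - real m) * real (Suc i)"
      by (subst prod.atLeast_Suc_lessThan; (simp del: prod.op_ivl_Suc)?)
         (simp add: prod.shift_bounds_Suc_ivl del: prod.op_ivl_Suc)
    thus ?case using Suc by simp
  qed auto
  have p2: "(\<Prod>m\<in>{b + i + 1..<b + i + 1 + j}. real (b + i) - real m) = (-1) ^ j * fact j"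
    by (induction j) (auto simp: algebra_simps)
  have "(\<Prod>m\<in>{b..<b + N} - {l}. real l - real m)
      = (\<Prod>m\<in>{b..<b + i}. real l - real m) * (\<Prod>m\<in>{b + i + 1..<b + i + 1 + j}. real l - real m)"
    unfolding split by (rule prod.union_disjoint) auto
  hence "(\<Prod>m\<in>{b..<b + N} - {l}. real l - real m) = fact i * ((-1) ^ j * fact j)"
    by (simp only: l_eq p1 p2)
  moreover have "(\<Prod>m\<in>{b..<b + N} - {l}. - real m) * real l * fact (b - 1) = (-1) ^ (i + j) * fact (b + N - 1)"
  proof -
    have *: "(\<Prod>m\<in>{b..<b + N} - {l}. - real m) = (-1) ^ (i + j) * (\<Prod>m\<in>{b..<b + N} - {l}. real m)"
      using l by (subst prod_uminus) (simp add: N)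
    have "(\<Prod>m\<in>{b..<b + N} - {l}. real m) * real l = (\<Prod>m\<in>{b..<b + N}. real m)"
      using l by (subst prod.remove [of _ l]) auto
    thus ?thesis using prod_fact [OF b, of N] by (simp add: * mult.assoc)
  qed
  ultimately have "L * (fact i * ((-1) ^ j * fact j)) * real l * fact (b - 1) = (-1) ^ (i + j) * fact (b + N - 1)"
    using L by simp
  hence eq: "L * (fact i * fact j * real l * fact (b - 1)) = (-1) ^ i * fact (b + N - 1)"
    by (cases "even j") (simp_all add: power_add algebra_simps)
  have "L = (-1) ^ i * fact (b + N - 1) / (fact i * fact j * real l * fact (b - 1))"
    using eq b l by (simp add: eq_divide_eq)
  moreover have "real ((N - 1) choose (l - b)) = fact (i + j) / (fact i * fact j)"
    by (simp add: N l_eq binomial_fact)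
  moreover have "real ((b + N - 1) choose b) = fact (b + N - 1) / (fact b * fact (i + j))"
    by (simp add: N binomial_fact)
  moreover have "fact b = real b * fact (b - 1)" using b by (simp add: fact_reduce)
  moreover have "(-1::real) ^ (b + l) = (-1) ^ i"
    by (cases "even b") (simp_all add: l_eq power_add)
  moreover have "real l \<noteq> 0" "real b \<noteq> 0" using b l by auto
  ultimately show ?thesis by simp
qed

text \<open>
  Optional stopping for \<open>q(x) = (\<Prod>m \<noteq> l. x - m)\<close>, of degree \<open>N - 1\<close>, isolates the landing site \<open>l\<close>.
\<close>

lemma sum_step_op_killed_law:
  fixes b l N :: nat
  assumes c: "0 < c" "c \<le> 2 / 4 ^ N" and N: "N \<ge> 1" and b: "b \<ge> 1" and l: "l \<in> {b..<b + N}"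
  shows "(\<Sum>k. step_op N c (killed_law N c (int b) 0 k) (int l)) =
              (-1) ^ (b + l) * (real b / real l) * real ((N - 1) choose (l - b)) *
              real ((b + N - 1) choose b)" (is "?L l = _")
proof (rule landing_value [OF l b])
  define A where "A = {b..<b + N} - {l}"
  define p where "p = (\<Prod>m\<in>A. [:- real m, 1:])"
  have "degree p = card A"
    unfolding p_def by (subst degree_prod_sum_eq) auto
  also have "\<dots> < N" using l N by (simp add: A_def)
  finally have deg: "degree p < N" .
  have poly_p: "poly p x = (\<Prod>m\<in>A. x - real m)" for x
    by (simp add: p_def poly_prod algebra_simps)
  have "poly p (real_of_int 0) = (\<Sum>i\<in>{int b..<int b + int N}.
      (\<Sum>k. step_op N c (killed_law N c (int b) 0 k) i) * poly p (real_of_int i))"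
    using b by (intro optional_stopping [OF _ c N funpow_fdiff_poly, symmetric]) (auto simp: deg)
  also have "\<dots> = (\<Sum>i\<in>{b..<b + N}. ?L i * poly p (real i))"
    by (rule sum.reindex_bij_witness [of _ int nat]) auto
  also have "\<dots> = (\<Sum>i\<in>{l}. ?L i * poly p (real i))"
    using l by (intro sum.mono_neutral_right) (auto simp: poly_p A_def)
  finally show "?L l * (\<Prod>m\<in>{b..<b + N} - {l}. real l - real m) = (\<Prod>m\<in>{b..<b + N} - {l}. - real m)"
    by (simp add: poly_p A_def)
qed

lemma sum_landing_eq_1:
  fixes b N :: nat
  assumes c: "0 < c" "c \<le> 2 / 4 ^ N" and N: "N \<ge> 1" and b: "b \<ge> 1"
  shows "(\<Sum>l\<in>{b..<b + N}. (\<Sum>k. step_op N c (killed_law N c (int b) 0 k) (int l))) = 1"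
proof -
  have "(\<Sum>l\<in>{b..<b + N}. (\<Sum>k. step_op N c (killed_law N c (int b) 0 k) (int l)))
     = (\<Sum>i\<in>{int b..<int b + int N}.
      (\<Sum>k. step_op N c (killed_law N c (int b) 0 k) i) * poly 1 (real_of_int i))"
    by (rule sum.reindex_bij_witness [of _ nat int]) auto
  also have "\<dots> = poly 1 (real_of_int 0)"
    using b N by (intro optional_stopping [OF _ c N funpow_fdiff_poly]) auto
  finally show ?thesis by simp
qed

section \<open>Overshoot coefficients as landing weights\<close>

text \<open>
  Markov property: conditioning on the last step.
\<close>

lemma pseudo_prob_Suc:
  assumes P: "\<And>u v. (\<And>i. i \<in> {1..n} \<Longrightarrow> u i = v i) \<Longrightarrow> P u \<longleftrightarrow> P v"
  shows "pseudo_prob N c (Suc n) {u. P u \<and> walk u (Suc n) = x} =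
         (\<Sum>j=-int N..int N. step_weight N c j * pseudo_prob N c n {u. P u \<and> walk u n = x - j})"
proof -
  let ?S = "{-int N..int N}"
  let ?w = "\<lambda>n u. \<Prod>i=1..n. step_weight N c (u i)"
  let ?ext = "\<lambda>(j, u). u(Suc n := j)"
  have ivl: "{1..Suc n} = insert (Suc n) {1..n}" by auto
  have agree_P: "P (u(Suc n := j)) \<longleftrightarrow> P u" for u j
    by (rule P) auto
  have agree: "walk (u(Suc n := j)) (Suc n) = walk u n + j"
    "?w (Suc n) (u(Suc n := j)) = step_weight N c j * ?w n u" for u j
    by (auto simp: walk_def ivl intro!: sum.cong prod.cong)
  have fin: "finite ({1..n} \<rightarrow>\<^sub>E ?S)" for n :: nat by (intro finite_PiE) auto
  have "pseudo_prob N c (Suc n) {u. P u \<and> walk u (Suc n) = x}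
      = (\<Sum>u\<in>{1..Suc n} \<rightarrow>\<^sub>E ?S. if P u \<and> walk u (Suc n) = x then ?w (Suc n) u else 0)"
    unfolding pseudo_prob_def by (subst sum.inter_restrict [OF fin]) simp
  also have "{1..Suc n} \<rightarrow>\<^sub>E ?S = ?ext ` (?S \<times> ({1..n} \<rightarrow>\<^sub>E ?S))"
    unfolding ivl by (rule PiE_insert_eq)
  also have "(\<Sum>u\<in>?ext ` (?S \<times> ({1..n} \<rightarrow>\<^sub>E ?S)). if P u \<and> walk u (Suc n) = x then ?w (Suc n) u else 0)
      = (\<Sum>(j, u)\<in>?S \<times> ({1..n} \<rightarrow>\<^sub>E ?S). if P u \<and> walk u n = x - j then step_weight N c j * ?w n u else 0)"
  proof (subst sum.reindex)
    show "inj_on ?ext (?S \<times> ({1..n} \<rightarrow>\<^sub>E ?S))" by (rule inj_combinator) auto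
    have "walk u n + j = x \<longleftrightarrow> walk u n = x - j" for u j by auto
    thus "sum ((\<lambda>u. if P u \<and> walk u (Suc n) = x then ?w (Suc n) u else 0) \<circ> ?ext) (?S \<times> ({1..n} \<rightarrow>\<^sub>E ?S))
      = (\<Sum>(j, u)\<in>?S \<times> ({1..n} \<rightarrow>\<^sub>E ?S). if P u \<and> walk u n = x - j then step_weight N c j * ?w n u else 0)"
      by (intro sum.cong refl) (simp only: o_apply split_def agree agree_P)
  qed
  also have "\<dots> = (\<Sum>j\<in>?S. \<Sum>u\<in>{1..n} \<rightarrow>\<^sub>E ?S. step_weight N c j * (if P u \<and> walk u n = x - j then ?w n u else 0))"
    by (subst sum.cartesian_product [symmetric]) (auto intro!: sum.cong)
  also have "\<dots> = (\<Sum>j\<in>?S. step_weight N c j * pseudo_prob N c n {u. P u \<and> walk u n = x - j})"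
    unfolding pseudo_prob_def by (subst sum.inter_restrict [OF fin]) (simp add: sum_distrib_left)
  finally show ?thesis .
qed

lemma walk_cong: "(\<And>i. i \<in> {1..n} \<Longrightarrow> u i = v i) \<Longrightarrow> walk u n = walk v n"
  by (simp add: walk_def)

lemma pseudo_prob_staying_below:
  assumes b: "b > 0"
  shows "pseudo_prob N c n {u. (\<forall>j\<in>{1..n}. walk u j < b) \<and> walk u n = x} = killed_law N c b 0 n x"
proof (induction n arbitrary: x)
  case 0
  show ?case
    by (auto simp: pseudo_prob_def walk_def killed_law_def unit_at_def)
next
  case (Suc n)
  let ?P = "\<lambda>u. \<forall>j\<in>{1..n}. walk u j < b"
  show ?case
  proof (cases "x < b")
    case True
    have "{u. (\<forall>j\<in>{1..Suc n}. walk u j < b) \<and> walk u (Suc n) = x} = {u. ?P u \<and> walk u (Suc n) = x}"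
      using True by (auto simp: le_Suc_eq)
    also have "pseudo_prob N c (Suc n) \<dots>
        = (\<Sum>j=-int N..int N. step_weight N c j * pseudo_prob N c n {u. ?P u \<and> walk u n = x - j})"
    proof (rule pseudo_prob_Suc)
      fix u v :: "nat \<Rightarrow> int" assume "\<And>i. i \<in> {1..n} \<Longrightarrow> u i = v i"
      hence "walk u j = walk v j" if "j \<in> {1..n}" for j using that by (intro walk_cong) auto
      thus "?P u \<longleftrightarrow> ?P v" by auto
    qed
    also have "\<dots> = killed_law N c b 0 (Suc n) x"
      using True by (simp only: Suc.IH killed_law_Suc killed_def step_op_def if_True)
    finally show ?thesis .
  next
    case False
    hence "{u. (\<forall>j\<in>{1..Suc n}. walk u j < b) \<and> walk u (Suc n) = x} = {}" by force
    hence "pseudo_prob N c (Suc n) {u. (\<forall>j\<in>{1..Suc n}. walk u j < b) \<and> walk u (Suc n) = x} = 0"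
      by (simp only: pseudo_prob_def Int_empty_right sum.empty)
    thus ?thesis using False by (simp only: killed_law_Suc killed_def if_False)
  qed
qed

text \<open>
  First passage at time \<open>k + 1\<close>: the walk stays below \<open>b\<close> for \<open>k\<close> steps and then jumps to \<open>l\<close>.
\<close>

lemma overshoot_coeff_Suc:
  assumes b: "b \<ge> 1" and l: "l \<ge> b"
  shows "overshoot_coeff N c b l (Suc k) = step_op N c (killed_law N c (int b) 0 k) (int l)"
proof -
  let ?P = "\<lambda>u. \<forall>j\<in>{1..k}. walk u j < int b"
  have "overshoot_coeff N c b l (Suc k) = pseudo_prob N c (Suc k) {u. ?P u \<and> walk u (Suc k) = int l}"
    using l by (subst overshoot_coeff_altdef) (auto simp: atLeastLessThanSuc_atLeastAtMost)
  also have "\<dots> = (\<Sum>j=-int N..int N. step_weight N c j * pseudo_prob N c k {u. ?P u \<and> walk u k = int l - j})"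
  proof (rule pseudo_prob_Suc)
    fix u v :: "nat \<Rightarrow> int" assume "\<And>i. i \<in> {1..k} \<Longrightarrow> u i = v i"
    hence "walk u j = walk v j" if "j \<in> {1..k}" for j using that by (intro walk_cong) auto
    thus "?P u \<longleftrightarrow> ?P v" by auto
  qed
  also have "\<dots> = step_op N c (killed_law N c (int b) 0 k) (int l)"
    using b by (subst pseudo_prob_staying_below) (simp_all add: step_op_def)
  finally show ?thesis .
qed

section \<open>Power series at the boundary of the unit disc\<close>

text \<open>
  Abel's limit theorem. Summation by parts turns the difference into \<open>(1 - t) (\<Sum>n. r n * t ^ n)\<close> with the
  tails \<open>r n\<close> of the series; the finitely many large tails are damped by \<open>1 - t\<close>, the others stay
  below \<open>e / 2\<close>, and the geometric weights \<open>(1 - t) t ^ n\<close> have total mass one.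
\<close>

lemma Abel_limit:
  fixes a :: "nat \<Rightarrow> real"
  assumes "summable a"
  shows "((\<lambda>t. \<Sum>k. a k * t ^ k) \<longlongrightarrow> (\<Sum>k. a k)) (at_left 1)"
proof -
  define S where "S = (\<Sum>k. a k)"
  define r where "r = (\<lambda>n. S - (\<Sum>k\<le>n. a k))"
  have "(\<lambda>n. \<Sum>k\<le>n. a k) \<longlonglongrightarrow> S"
    using assms unfolding S_def by (rule summable_LIMSEQ')
  hence r_lim: "r \<longlonglongrightarrow> 0"
    unfolding r_def by (intro tendsto_eq_intros) auto
  then obtain M where M: "\<And>n. \<bar>r n\<bar> \<le> M"
    using Bseq_def convergentI convergent_imp_Bseq real_norm_def by metis
  have summ: "summable (\<lambda>n. r n * t ^ n)" "summable (\<lambda>k. a k * t ^ k)" "summable (\<lambda>n. \<bar>r n\<bar> * t ^ n)"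
    and eq: "S - (\<Sum>k. a k * t ^ k) = (1 - t) * (\<Sum>n. r n * t ^ n)"
    if t: "0 < t" "t < 1" for t
  proof -
    show 1: "summable (\<lambda>n. \<bar>r n\<bar> * t ^ n)"
      by (rule summable_comparison_test' [of "\<lambda>n. M * t ^ n"])
         (use t M in \<open>auto intro!: summable_mult summable_geometric mult_right_mono simp: abs_mult\<close>)
    show r: "summable (\<lambda>n. r n * t ^ n)"
      by (rule summable_rabs_cancel) (use 1 t in \<open>simp add: abs_mult\<close>)
    have "(\<lambda>n. r n * t ^ n) sums (\<Sum>n. r n * t ^ n)" using r by (rule summable_sums)
    hence s1: "(\<lambda>n. t * (r n * t ^ n)) sums (t * (\<Sum>n. r n * t ^ n))" by (rule sums_mult)
    have s2: "(\<lambda>n. r (Suc n) * t ^ Suc n) sums ((\<Sum>n. r n * t ^ n) - r 0)"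
      using r sums_Suc_iff [of "\<lambda>n. r n * t ^ n" "(\<Sum>n. r n * t ^ n) - r 0"] by (simp add: summable_sums)
    have "(\<lambda>n. t * (r n * t ^ n) - r (Suc n) * t ^ Suc n) sums (t * (\<Sum>n. r n * t ^ n) - ((\<Sum>n. r n * t ^ n) - r 0))"
      by (rule sums_diff [OF s1 s2])
    moreover have "t * (r n * t ^ n) - r (Suc n) * t ^ Suc n = a (Suc n) * t ^ Suc n" for n
      by (simp add: r_def algebra_simps)
    ultimately have "(\<lambda>n. a (Suc n) * t ^ Suc n) sums (t * (\<Sum>n. r n * t ^ n) - ((\<Sum>n. r n * t ^ n) - r 0))"
      by simp
    hence "(\<lambda>n. a n * t ^ n) sums (t * (\<Sum>n. r n * t ^ n) - ((\<Sum>n. r n * t ^ n) - r 0) + a 0)"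
      using sums_Suc_iff [of "\<lambda>n. a n * t ^ n"] by simp
    thus "summable (\<lambda>k. a k * t ^ k)" "S - (\<Sum>k. a k * t ^ k) = (1 - t) * (\<Sum>n. r n * t ^ n)"
      by (auto simp: sums_iff r_def algebra_simps)
  qed
  have "((\<lambda>t. S - (\<Sum>k. a k * t ^ k)) \<longlongrightarrow> 0) (at_left 1)"
  proof (rule tendstoI)
    fix e :: real assume e: "e > 0"
    obtain K where K: "\<And>n. n \<ge> K \<Longrightarrow> \<bar>r n\<bar> < e / 2"
      using LIMSEQ_D [OF r_lim, of "e / 2"] e by auto
    have "((\<lambda>t. (1 - t) * (\<Sum>n<K. \<bar>r n\<bar>)) \<longlongrightarrow> (1 - 1) * (\<Sum>n<K. \<bar>r n\<bar>)) (at_left 1)"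
      by (intro tendsto_intros)
    hence ev: "\<forall>\<^sub>F t in at_left 1. (1 - t) * (\<Sum>n<K. \<bar>r n\<bar>) < e / 2"
      using e by (intro order_tendstoD) auto
    have "\<forall>\<^sub>F t in at_left (1::real). t \<in> {0<..<1}"
      by (rule eventually_at_leftI [of 0]) auto
    with ev show "\<forall>\<^sub>F t in at_left 1. dist (S - (\<Sum>k. a k * t ^ k)) 0 < e"
    proof eventually_elim
      case (elim t)
      hence t: "0 < t" "t < 1" by auto
      have "\<bar>\<Sum>n. r n * t ^ n\<bar> \<le> (\<Sum>n. \<bar>r n\<bar> * t ^ n)"
        using summable_rabs [of "\<lambda>n. r n * t ^ n"] summ [OF t] t by (simp add: abs_mult)
      also have "\<dots> = (\<Sum>n. \<bar>r (n + K)\<bar> * t ^ (n + K)) + (\<Sum>n<K. \<bar>r n\<bar> * t ^ n)"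
        by (rule suminf_split_initial_segment [OF summ(3) [OF t]])
      also have "(\<Sum>n<K. \<bar>r n\<bar> * t ^ n) \<le> (\<Sum>n<K. \<bar>r n\<bar>)"
        using t by (intro sum_mono mult_left_le) (auto simp: power_le_one)
      also have "(\<Sum>n. \<bar>r (n + K)\<bar> * t ^ (n + K)) \<le> (\<Sum>n. e / 2 * t ^ n)"
      proof (rule suminf_le)
        fix n
        have "\<bar>r (n + K)\<bar> * t ^ (n + K) \<le> e / 2 * t ^ n"
          using K [of "n + K"] t by (intro mult_mono power_decreasing) auto
        thus "\<bar>r (n + K)\<bar> * t ^ (n + K) \<le> e / 2 * t ^ n" .
      next
        show "summable (\<lambda>n. \<bar>r (n + K)\<bar> * t ^ (n + K))"
          by (rule summable_ignore_initial_segment [OF summ(3) [OF t]])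
        show "summable (\<lambda>n. e / 2 * t ^ n)"
          using t by (intro summable_mult summable_geometric) simp
      qed
      also have "(\<Sum>n. e / 2 * t ^ n) = e / 2 / (1 - t)"
        using t by (subst suminf_mult) (auto simp: suminf_geometric)
      finally have le: "\<bar>\<Sum>n. r n * t ^ n\<bar> \<le> e / 2 / (1 - t) + (\<Sum>n<K. \<bar>r n\<bar>)" by simp
      have "\<bar>S - (\<Sum>k. a k * t ^ k)\<bar> = (1 - t) * \<bar>\<Sum>n. r n * t ^ n\<bar>"
        using t by (simp add: eq [OF t] abs_mult)
      also have "\<dots> \<le> (1 - t) * (e / 2 / (1 - t) + (\<Sum>n<K. \<bar>r n\<bar>))"
        using t le by (intro mult_left_mono) auto
      also have "\<dots> = e / 2 + (1 - t) * (\<Sum>n<K. \<bar>r n\<bar>)"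
      proof -
        have "(1 - t) * (e / 2 / (1 - t)) = e / 2"
          using t by (subst times_divide_eq_right, intro nonzero_mult_div_cancel_left) simp
        thus ?thesis by (simp only: distrib_left)
      qed
      also have "\<dots> < e" using elim by simp
      finally show ?case by simp
    qed
  qed
  from tendsto_diff [OF tendsto_const [of S] this] show ?thesis by (simp add: S_def)
qed

lemma holomorphic_powser_unit_disc:
  fixes a :: "nat \<Rightarrow> real"
  assumes "summable a"
  shows "(\<lambda>z. \<Sum>k. complex_of_real (a k) * z ^ k) holomorphic_on ball 0 1"
    and "norm z < 1 \<Longrightarrow> (\<lambda>k. complex_of_real (a k) * z ^ k) sums (\<Sum>k. complex_of_real (a k) * z ^ k)"
proof -
  have "summable (\<lambda>k. complex_of_real (a k) * 1 ^ k)"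
    using assms by (simp add: summable_of_real)
  hence *: "summable (\<lambda>k. complex_of_real (a k) * z ^ k)" if "norm z < 1" for z
    using powser_inside [of "\<lambda>k. complex_of_real (a k)" 1 z] that by simp
  thus "norm z < 1 \<Longrightarrow> (\<lambda>k. complex_of_real (a k) * z ^ k) sums (\<Sum>k. complex_of_real (a k) * z ^ k)"
    by (auto intro: summable_sums)
  show "(\<lambda>z. \<Sum>k. complex_of_real (a k) * z ^ k) holomorphic_on ball 0 1"
    by (rule power_series_holomorphic [where a = "\<lambda>k. complex_of_real (a k)"])
       (use * in \<open>auto intro: summable_sums\<close>)
qed

lemma suminf_powser_of_real:
  assumes "summable a" "0 \<le> t" "t < 1"
  shows "(\<Sum>k. complex_of_real (a k) * complex_of_real t ^ k) = complex_of_real (\<Sum>k. a k * t ^ k)"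
proof -
  have "summable (\<lambda>k. a k * t ^ k)"
    using powser_inside [of a 1 t] assms by simp
  thus ?thesis by (subst suminf_of_real) simp_all
qed

section \<open>Changing the laziness of the walk\<close>

text \<open>
  The recurrence makes \<open>\<beta> n 0\<close> the binomial transform of \<open>\<beta> 0\<close>, that is
  \<open>\<beta> n 0 = (\<Sum>j\<le>n. (n choose j) (1 - q)\<^sup>n\<^sup>-\<^sup>j q\<^sup>j \<beta> 0 j)\<close>. The generating functions \<open>\<Phi> i\<close> of \<open>\<beta> \<cdot> i\<close> satisfy
  \<open>(1 - (1 - q) z) \<Phi> i = \<beta> 0 i + q z \<Phi> (i + 1)\<close>; iterating this relation from \<open>i = 0\<close> produces the
  partial sums of the power series in \<open>w\<close>, and the remainder \<open>w\<^sup>J \<Phi> J\<close> tends to \<open>0\<close> because the \<open>\<Phi> i\<close> are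
  uniformly bounded.
\<close>

lemma binomial_transform_powser:
  fixes \<beta> :: "nat \<Rightarrow> nat \<Rightarrow> real" and q :: real and z :: complex
  assumes rec: "\<And>n i. \<beta> (Suc n) i = (1 - q) * \<beta> n i + q * \<beta> n (Suc i)"
    and bdd: "\<And>i. \<bar>\<beta> 0 i\<bar> \<le> M"
    and q: "q > 0" and z: "(\<bar>1 - q\<bar> + q) * norm z < 1"
  defines "w \<equiv> of_real q * z / (1 - of_real (1 - q) * z)"
  shows "norm w < 1"
    and "(\<lambda>n. of_real (\<beta> n 0) * z ^ n) sums
           ((\<Sum>j. of_real (\<beta> 0 j) * w ^ j) / (1 - of_real (1 - q) * z))"
proof -
  define X where "X = \<bar>1 - q\<bar> + q"
  define d where "d = 1 - of_real (1 - q) * z"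
  have nz: "norm (of_real (1 - q) * z) = \<bar>1 - q\<bar> * norm z"
    by (simp only: norm_mult norm_of_real)
  have d: "norm (of_real q * z) < norm d"
  proof -
    have "norm (of_real q * z) = q * norm z" using q by (simp add: norm_mult)
    also have "\<dots> < 1 - \<bar>1 - q\<bar> * norm z" using z by (simp add: algebra_simps)
    also have "\<dots> = norm (1::complex) - norm (of_real (1 - q) * z)" by (simp only: nz norm_one)
    also have "\<dots> \<le> norm d" unfolding d_def by (rule norm_triangle_ineq2)
    finally show ?thesis .
  qed
  hence d0: "d \<noteq> 0" by auto
  show w: "norm w < 1"
    using d d0 unfolding w_def d_def [symmetric] by (simp add: norm_divide divide_less_eq)
  have M: "M \<ge> 0" using bdd [of 0] by linarith
  have X: "X > 0" using q by (simp add: X_def)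
  have bd: "\<bar>\<beta> n i\<bar> \<le> M * X ^ n" for n i
  proof (induction n arbitrary: i)
    case (Suc n)
    have "\<bar>\<beta> (Suc n) i\<bar> \<le> \<bar>1 - q\<bar> * \<bar>\<beta> n i\<bar> + q * \<bar>\<beta> n (Suc i)\<bar>"
      unfolding rec using q by (intro order.trans [OF abs_triangle_ineq]) (simp add: abs_mult)
    also have "\<dots> \<le> \<bar>1 - q\<bar> * (M * X ^ n) + q * (M * X ^ n)"
      using Suc q by (intro add_mono mult_left_mono) auto
    finally show ?case by (simp add: X_def algebra_simps)
  qed (use bdd in simp)
  \<comment> \<open>The condition on \<open>z\<close> makes the crude growth bound \<open>X\<^sup>n\<close> summable against \<open>|z|\<^sup>n\<close>.\<close>
  have geo: "(\<lambda>n. M * (X * norm z) ^ n) sums (M / (1 - X * norm z))"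
    using z X sums_mult [OF geometric_sums [of "X * norm z"], of M] by (simp add: X_def abs_mult)
  have le: "norm (of_real (\<beta> n i) * z ^ n) \<le> M * (X * norm z) ^ n" for n i
    using mult_right_mono [OF bd [of n i], of "norm z ^ n"]
    by (simp add: norm_mult norm_power power_mult_distrib mult.assoc)
  have summ: "summable (\<lambda>n. of_real (\<beta> n i) * z ^ n)" for i
    by (rule summable_comparison_test' [OF sums_summable [OF geo]]) (rule le)
  define \<Phi> where "\<Phi> = (\<lambda>i. \<Sum>n. of_real (\<beta> n i) * z ^ n)"
  have \<Phi>_sums: "(\<lambda>n. of_real (\<beta> n i) * z ^ n) sums \<Phi> i" for i
    unfolding \<Phi>_def using summ by (rule summable_sums)
  have \<Phi>_le: "norm (\<Phi> i) \<le> M / (1 - X * norm z)" for i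
    unfolding \<Phi>_def sums_unique [OF geo] using le sums_summable [OF geo] by (rule norm_suminf_le)
  have \<Phi>_rec: "\<Phi> i = of_real (\<beta> 0 i) / d + w * \<Phi> (Suc i)" for i
  proof -
    have "(\<lambda>n. z * (of_real (1 - q) * (of_real (\<beta> n i) * z ^ n) + of_real q * (of_real (\<beta> n (Suc i)) * z ^ n)))
        sums (z * (of_real (1 - q) * \<Phi> i + of_real q * \<Phi> (Suc i)))"
      by (intro sums_mult sums_add \<Phi>_sums)
    moreover have "z * (of_real (1 - q) * (of_real (\<beta> n i) * z ^ n) + of_real q * (of_real (\<beta> n (Suc i)) * z ^ n))
        = of_real (\<beta> (Suc n) i) * z ^ Suc n" for n
      by (simp add: rec algebra_simps)
    ultimately have "(\<lambda>n. of_real (\<beta> (Suc n) i) * z ^ Suc n) sums (z * (of_real (1 - q) * \<Phi> i + of_real q * \<Phi> (Suc i)))"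
      by (simp only:)
    hence "(\<lambda>n. of_real (\<beta> n i) * z ^ n) sums (z * (of_real (1 - q) * \<Phi> i + of_real q * \<Phi> (Suc i)) + of_real (\<beta> 0 i))"
      using sums_Suc_iff [of "\<lambda>n. of_real (\<beta> n i) * z ^ n"] by simp
    hence "\<Phi> i = z * (of_real (1 - q) * \<Phi> i + of_real q * \<Phi> (Suc i)) + of_real (\<beta> 0 i)"
      using \<Phi>_sums [of i] sums_unique2 by blast
    hence "d * \<Phi> i = of_real (\<beta> 0 i) + of_real q * z * \<Phi> (Suc i)"
      by (simp add: d_def algebra_simps)
    hence "\<Phi> i = (of_real (\<beta> 0 i) + of_real q * z * \<Phi> (Suc i)) / d"
      using d0 by (simp add: eq_divide_eq mult.commute)
    thus ?thesis unfolding w_def d_def [symmetric] by (simp add: add_divide_distrib)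
  qed
  have partial: "\<Phi> 0 = (\<Sum>j<J. of_real (\<beta> 0 j) * w ^ j) / d + w ^ J * \<Phi> J" for J
  proof (induction J)
    case (Suc J)
    show ?case
      by (subst Suc, subst \<Phi>_rec [of J]) (simp add: algebra_simps add_divide_distrib)
  qed auto
  have "(\<lambda>J. w ^ J * \<Phi> J) \<longlonglongrightarrow> 0"
  proof (rule Lim_null_comparison)
    show "\<forall>\<^sub>F J in sequentially. norm (w ^ J * \<Phi> J) \<le> norm w ^ J * (M / (1 - X * norm z))"
      unfolding norm_mult norm_power
      by (intro always_eventually allI mult_left_mono \<Phi>_le zero_le_power norm_ge_zero)
    show "(\<lambda>J. norm w ^ J * (M / (1 - X * norm z))) \<longlonglongrightarrow> 0"
      using w by (intro tendsto_mult_left_zero LIMSEQ_power_zero) auto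
  qed
  hence "(\<lambda>J. d * (\<Phi> 0 - w ^ J * \<Phi> J)) \<longlonglongrightarrow> d * (\<Phi> 0 - 0)"
    by (intro tendsto_intros)
  moreover have "d * (\<Phi> 0 - w ^ J * \<Phi> J) = (\<Sum>j<J. of_real (\<beta> 0 j) * w ^ j)" for J
    using partial [of J] d0 by simp
  ultimately have "(\<lambda>j. of_real (\<beta> 0 j) * w ^ j) sums (d * \<Phi> 0)" by (simp add: sums_def)
  hence "(\<Sum>j. of_real (\<beta> 0 j) * w ^ j) = d * \<Phi> 0" by (simp add: sums_iff)
  thus "(\<lambda>n. of_real (\<beta> n 0) * z ^ n) sums ((\<Sum>j. of_real (\<beta> 0 j) * w ^ j) / (1 - of_real (1 - q) * z))"
    using \<Phi>_sums [of 0] d0 unfolding d_def [symmetric] by simp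
qed

lemma continued_value_at_1_suminf:
  assumes "summable a" shows "continued_value_at_1 a (\<Sum>k. a k)"
  unfolding continued_value_at_1_def
proof (intro exI conjI)
  let ?f = "\<lambda>z. \<Sum>k. complex_of_real (a k) * z ^ k"
  show "?f holomorphic_on ball 0 1" by (rule holomorphic_powser_unit_disc [OF assms])
  show "\<forall>\<^sub>F z in nhds 0. (\<lambda>k. complex_of_real (a k) * z ^ k) sums ?f z"
    unfolding eventually_nhds_metric using holomorphic_powser_unit_disc(2) [OF assms]
    by (intro exI [of _ 1]) auto
  have "((\<lambda>t. complex_of_real (\<Sum>k. a k * t ^ k)) \<longlongrightarrow> complex_of_real (\<Sum>k. a k)) (at_left 1)"
    by (intro tendsto_of_real Abel_limit assms)
  moreover have "\<forall>\<^sub>F t in at_left (1::real). t \<in> {0<..<1}"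
    by (rule eventually_at_leftI [of 0]) auto
  hence "\<forall>\<^sub>F t in at_left 1. complex_of_real (\<Sum>k. a k * t ^ k) = ?f (complex_of_real t)"
    by eventually_elim (simp add: suminf_powser_of_real assms)
  ultimately show "((\<lambda>t. ?f (complex_of_real t)) \<longlongrightarrow> complex_of_real (\<Sum>k. a k)) (at_left 1)"
    by (rule Lim_transform_eventually)
qed auto

text \<open>
  The Moebius map \<open>\<tau>\<close> sends \<open>[0, 1)\<close> into itself and tends to \<open>1\<close> at \<open>1\<close>, so composing the power
  series of \<open>a'\<close> on the unit disc with \<open>\<tau>\<close> continues the power series of \<open>a\<close> along the segment.
  The domain is the component of \<open>0\<close> in the preimage of the unit disc under \<open>\<tau>\<close>, where the pole
  of \<open>\<tau>\<close> is excluded automatically.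
\<close>

lemma continued_value_at_1_moebius:
  fixes a a' :: "nat \<Rightarrow> real"
  assumes a': "summable a'" and q: "q > 0"
    and sums: "\<forall>\<^sub>F z in nhds 0. (\<lambda>k. of_real (a k) * z ^ k) sums
        (\<Sum>k. of_real (a' k) * (of_real q * z / (1 - of_real (1 - q) * z)) ^ k :: complex)"
  shows "continued_value_at_1 a (\<Sum>k. a' k)"
proof -
  define F where "F = (\<lambda>z. \<Sum>k. complex_of_real (a' k) * z ^ k)"
  define \<tau> where "\<tau> = (\<lambda>z. complex_of_real q * z / (1 - of_real (1 - q) * z))"
  define D0 where "D0 = {z. norm (complex_of_real q * z) < norm (1 - complex_of_real (1 - q) * z)}"
  define D where "D = connected_component_set D0 0"
  have "open D0" unfolding D0_def by (intro open_Collect_less continuous_intros)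
  hence D: "open D" "connected D" "D \<subseteq> D0"
    unfolding D_def using open_connected_component connected_connected_component
      connected_component_subset by blast+
  \<comment> \<open>For real \<open>t < 1\<close> the inequality \<open>q t < 1 - (1 - q) t\<close> just says \<open>t < 1\<close>.\<close>
  have seg: "complex_of_real ` {0..<1} \<subseteq> D0"
  proof
    fix z assume "z \<in> complex_of_real ` {0..<1}"
    then obtain t where t: "z = of_real t" "0 \<le> t" "t < 1" by auto
    have "complex_of_real q * z = of_real (q * t)" "1 - complex_of_real (1 - q) * z = of_real (1 - (1 - q) * t)"
      by (simp_all add: t)
    hence "norm (complex_of_real q * z) = \<bar>q * t\<bar>" "norm (1 - complex_of_real (1 - q) * z) = \<bar>1 - (1 - q) * t\<bar>"
      by (simp_all only: norm_of_real)
    moreover have "q * t < 1 - (1 - q) * t" "0 \<le> q * t" using t q by (auto simp: algebra_simps)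
    ultimately show "z \<in> D0" by (simp add: D0_def)
  qed
  have "connected (complex_of_real ` {0..<1})"
    by (intro connected_continuous_image continuous_intros) auto
  moreover have "0 \<in> complex_of_real ` {0..<1}" by (auto simp: image_iff intro!: bexI [of _ 0])
  ultimately have seg_D: "complex_of_real ` {0..<1} \<subseteq> D"
    unfolding D_def using seg by (intro connected_component_maximal)
  have nz: "1 - complex_of_real (1 - q) * z \<noteq> 0" "norm (\<tau> z) < 1" if "z \<in> D" for z
  proof -
    have *: "norm (complex_of_real q * z) < norm (1 - complex_of_real (1 - q) * z)"
      using that D(3) by (auto simp: D0_def)
    thus "1 - complex_of_real (1 - q) * z \<noteq> 0" by auto
    with * show "norm (\<tau> z) < 1" unfolding \<tau>_def norm_divide by (simp only: divide_less_eq zero_less_norm_iff) simp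
  qed
  have "\<tau> holomorphic_on D"
    unfolding \<tau>_def by (intro holomorphic_intros nz)
  moreover have "F holomorphic_on ball 0 1"
    unfolding F_def by (rule holomorphic_powser_unit_disc [OF a'])
  moreover have "\<tau> ` D \<subseteq> ball 0 1" using nz by auto
  ultimately have hol: "(F \<circ> \<tau>) holomorphic_on D"
    by (rule holomorphic_on_compose_gen)
  define s where "s = (\<lambda>t. q * t / (1 - (1 - q) * t))"
  have s: "0 < s t" "s t < 1" if "t \<in> {0<..<1}" for t
  proof -
    have "q * t < 1 - (1 - q) * t" "0 < q * t" using that q by (auto simp: algebra_simps)
    thus "0 < s t" "s t < 1" by (auto simp: s_def)
  qed
  have ev: "\<forall>\<^sub>F t in at_left (1::real). t \<in> {0<..<1}"
    by (rule eventually_at_leftI [of 0]) auto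
  have "(s \<longlongrightarrow> q * 1 / (1 - (1 - q) * 1)) (at_left 1)"
    unfolding s_def using q by (intro tendsto_intros) auto
  moreover have "\<forall>\<^sub>F t in at_left 1. s t \<in> {..<1} \<and> s t \<noteq> 1"
    using ev by eventually_elim (use s in force)
  ultimately have "filterlim s (at_left 1) (at_left 1)"
    using q by (simp add: filterlim_at)
  hence "((\<lambda>t. \<Sum>k. a' k * s t ^ k) \<longlongrightarrow> (\<Sum>k. a' k)) (at_left 1)"
    by (rule filterlim_compose [OF Abel_limit [OF a']])
  hence "((\<lambda>t. complex_of_real (\<Sum>k. a' k * s t ^ k)) \<longlongrightarrow> complex_of_real (\<Sum>k. a' k)) (at_left 1)"
    by (rule tendsto_of_real)
  moreover have "\<forall>\<^sub>F t in at_left 1. complex_of_real (\<Sum>k. a' k * s t ^ k) = (F \<circ> \<tau>) (complex_of_real t)"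
    using ev
  proof eventually_elim
    case (elim t)
    have "\<tau> (complex_of_real t) = of_real (s t)" by (simp add: \<tau>_def s_def)
    thus ?case using s [OF elim] by (simp add: F_def suminf_powser_of_real [OF a'])
  qed
  ultimately have lim: "((\<lambda>t. (F \<circ> \<tau>) (complex_of_real t)) \<longlongrightarrow> complex_of_real (\<Sum>k. a' k)) (at_left 1)"
    by (rule Lim_transform_eventually)
  have "\<forall>\<^sub>F z in nhds 0. (\<lambda>k. complex_of_real (a k) * z ^ k) sums (F \<circ> \<tau>) z"
    using sums by (simp add: F_def \<tau>_def)
  with D seg_D hol lim show ?thesis unfolding continued_value_at_1_def by blast
qed

lemma step_op_lincomb:
  "step_op N c (\<lambda>x. \<alpha> * u x + \<beta> * v x) y = \<alpha> * step_op N c u y + \<beta> * step_op N c v y"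
  by (simp add: step_op_def sum_distrib_left sum.distrib algebra_simps)

lemma funpow_killed_lincomb:
  "(killed N c b ^^ n) (\<lambda>x. \<alpha> * u x + \<beta> * v x)
     = (\<lambda>x. \<alpha> * (killed N c b ^^ n) u x + \<beta> * (killed N c b ^^ n) v x)"
  by (induction n) (auto simp: killed_def [abs_def] step_op_lincomb)

lemma step_op_rescale: "step_op N (q * c) u y = (1 - q) * u y + q * step_op N c u y"
  by (simp add: step_op_eq algebra_simps)

lemma killed_rescale:
  assumes "supp_below b u"
  shows "killed N (q * c) b u = (\<lambda>y. (1 - q) * u y + q * killed N c b u y)"
  using assms by (auto simp: killed_def step_op_rescale supp_below_def)

text \<open>
  Let \<open>\<beta> n i\<close> be the landing weight at \<open>l\<close> after \<open>i\<close> steps with parameter \<open>c\<close>, then \<open>n\<close> steps with parameter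
  \<open>q c\<close>, then a last step with parameter \<open>c\<close>. Replacing one of the middle steps by the signed mixture of
  standing still and a step with parameter \<open>c\<close> is the recurrence of the binomial transform, which thus
  interpolates between the two walks.
\<close>

lemma overshoot_coeff_rescale:
  assumes b: "b \<ge> 1" and l: "l \<ge> b" and q: "q > 0" and summ: "summable (overshoot_coeff N c b l)"
  shows "\<forall>\<^sub>F z in nhds 0. (\<lambda>k. of_real (overshoot_coeff N (q * c) b l k) * z ^ k) sums
     (\<Sum>k. of_real (overshoot_coeff N c b l k) * (of_real q * z / (1 - of_real (1 - q) * z)) ^ k :: complex)"
proof -
  define \<beta> where "\<beta> = (\<lambda>n i. step_op N c ((killed N (q * c) (int b) ^^ n) (killed_law N c (int b) 0 i)) (int l))"
  have supp: "supp_below (int b) (killed_law N c (int b) 0 i)" for c i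
    using b by (intro supp_below_killed_law) auto
  have rec: "\<beta> (Suc n) i = (1 - q) * \<beta> n i + q * \<beta> n (Suc i)" for n i
  proof -
    have "(killed N (q * c) (int b) ^^ Suc n) (killed_law N c (int b) 0 i)
       = (killed N (q * c) (int b) ^^ n)
           (\<lambda>y. (1 - q) * killed_law N c (int b) 0 i y + q * killed_law N c (int b) 0 (Suc i) y)"
      by (simp add: funpow_Suc_right killed_rescale [OF supp] killed_law_Suc del: funpow.simps(2))
    thus ?thesis by (simp only: \<beta>_def funpow_killed_lincomb step_op_lincomb)
  qed
  have \<beta>0: "\<beta> 0 i = overshoot_coeff N c b l (Suc i)" for i
    by (simp add: \<beta>_def overshoot_coeff_Suc [OF b l])
  have coeff: "overshoot_coeff N (q * c) b l (Suc n) = q * \<beta> n 0" for n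
  proof -
    have "killed_law N (q * c) (int b) 0 n (int l) = 0"
      using supp [of "q * c" n] l by (simp add: supp_below_def)
    thus ?thesis
      by (simp add: overshoot_coeff_Suc [OF b l] step_op_rescale \<beta>_def killed_law_def)
  qed
  have "summable (\<beta> 0)"
    using summ unfolding \<beta>0 [abs_def] by (subst summable_Suc_iff)
  hence "Bseq (\<beta> 0)" by (intro convergent_imp_Bseq) (auto simp: convergent_def dest: summable_LIMSEQ_zero)
  then obtain M where M: "\<And>i. \<bar>\<beta> 0 i\<bar> \<le> M" unfolding Bseq_def real_norm_def by blast
  define X where "X = \<bar>1 - q\<bar> + q"
  have X: "X > 0" using q by (simp add: X_def)
  show ?thesis
    unfolding eventually_nhds_metric
  proof (intro exI [of _ "1 / X"] conjI allI impI)
    fix z :: complex assume "dist z 0 < 1 / X"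
    hence z: "(\<bar>1 - q\<bar> + q) * norm z < 1" using X by (simp add: X_def field_simps)
    define w where "w = of_real q * z / (1 - of_real (1 - q) * z)"
    note T = binomial_transform_powser [where \<beta> = \<beta>, OF rec M q z, folded w_def]
    define S where "S = (\<Sum>j. complex_of_real (\<beta> 0 j) * w ^ j)"
    have "(\<lambda>n. of_real q * z * (of_real (\<beta> n 0) * z ^ n)) sums (of_real q * z * (S / (1 - of_real (1 - q) * z)))"
      unfolding S_def by (intro sums_mult T)
    moreover have "of_real q * z * (of_real (\<beta> n 0) * z ^ n)
        = of_real (overshoot_coeff N (q * c) b l (Suc n)) * z ^ Suc n" for n
      by (simp add: coeff)
    moreover have "of_real q * z * (S / (1 - of_real (1 - q) * z)) = w * S"
      by (simp add: w_def)
    ultimately have "(\<lambda>n. of_real (overshoot_coeff N (q * c) b l (Suc n)) * z ^ Suc n) sums (w * S)"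
      by (simp only:)
    hence *: "(\<lambda>k. of_real (overshoot_coeff N (q * c) b l k) * z ^ k) sums (w * S)"
      using sums_Suc_iff [of "\<lambda>k. of_real (overshoot_coeff N (q * c) b l k) * z ^ k" "w * S"]
      by (simp add: overshoot_coeff_0)
    have "(\<lambda>j. complex_of_real (\<beta> 0 j) * w ^ j) sums S"
      unfolding S_def by (rule holomorphic_powser_unit_disc(2) [OF \<open>summable (\<beta> 0)\<close> T(1)])
    hence "(\<lambda>j. w * (complex_of_real (\<beta> 0 j) * w ^ j)) sums (w * S)" by (rule sums_mult)
    hence "(\<lambda>j. complex_of_real (overshoot_coeff N c b l (Suc j)) * w ^ Suc j) sums (w * S)"
      by (simp add: \<beta>0 mult_ac)
    hence "(\<lambda>k. complex_of_real (overshoot_coeff N c b l k) * w ^ k) sums (w * S)"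
      using sums_Suc_iff [of "\<lambda>k. complex_of_real (overshoot_coeff N c b l k) * w ^ k" "w * S"]
      by (simp add: overshoot_coeff_0)
    with * show "(\<lambda>k. of_real (overshoot_coeff N (q * c) b l k) * z ^ k) sums
       (\<Sum>k. of_real (overshoot_coeff N c b l k) * (of_real q * z / (1 - of_real (1 - q) * z)) ^ k)"
      unfolding w_def [symmetric] by (simp add: sums_iff)
  qed (use X in auto)
qed

section \<open>Overshoot probabilities\<close>

text \<open>
  A convergent series has its sum as continued value, by Abel's theorem, and the
  continued value is unique.
\<close>

lemma overshoot_prob_eq:
  assumes "continued_value_at_1 (overshoot_coeff N c b l) L"
  shows "overshoot_prob N c b l = L"
proof (cases "summable (overshoot_coeff N c b l)")
  case True
  thus ?thesis
    using continued_value_at_1_unique [OF continued_value_at_1_suminf assms] by (simp add: overshoot_prob_def)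
next
  case False
  thus ?thesis
    using assms continued_value_at_1_unique by (auto simp: overshoot_prob_def intro!: the_equality)
qed

lemma overshoot_coeff_sums:
  assumes c: "0 < c" "c \<le> 2 / 4 ^ N" and N: "N \<ge> 1" and b: "b \<ge> 1" and l: "l \<ge> b"
  shows "overshoot_coeff N c b l sums (\<Sum>k. step_op N c (killed_law N c (int b) 0 k) (int l))"
proof -
  have "summable (\<lambda>k. step_op N c (killed_law N c (int b) 0 k) (int l))"
    using b by (intro summable_rabs_cancel [OF summable_step_op_killed_law] c N) auto
  hence "(\<lambda>k. overshoot_coeff N c b l (Suc k)) sums (\<Sum>k. step_op N c (killed_law N c (int b) 0 k) (int l))"
    by (simp add: overshoot_coeff_Suc [OF b l] summable_sums)
  thus ?thesis by (simp add: sums_Suc_iff overshoot_coeff_0)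
qed

text \<open>
  The value does not depend on \<open>c\<close>: rescaling to the critical parameter \<open>2 / 4 ^ N\<close>, the largest one
  covered by the summability lemmas, leaves the continued value unchanged.
\<close>

lemma overshoot_prob_critical:
  assumes c: "c > 0" and N: "N \<ge> 1" and b: "b \<ge> 1" and l: "l \<ge> b"
  shows "overshoot_prob N c b l
       = (\<Sum>k. step_op N (2 / 4 ^ N) (killed_law N (2 / 4 ^ N) (int b) 0 k) (int l))"
proof -
  define q where "q = c / (2 / 4 ^ N)"
  have q: "q > 0" "q * (2 / 4 ^ N) = c" using c by (simp_all add: q_def)
  note sums = overshoot_coeff_sums [of "2 / 4 ^ N" N b l, OF _ order.refl N b l, simplified]
  have "continued_value_at_1 (overshoot_coeff N c b l) (\<Sum>k. overshoot_coeff N (2 / 4 ^ N) b l k)"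
    using continued_value_at_1_moebius [OF sums_summable [OF sums] q(1)
        overshoot_coeff_rescale [OF b l q(1) sums_summable [OF sums]]] by (simp only: q(2))
  from overshoot_prob_eq [OF this] sums show ?thesis by (simp add: sums_iff)
qed

theorem theorem5p7:
  fixes N b :: nat and c :: real
  assumes "N \<ge> 1" and "b \<ge> 1" and "c > 0"
  shows "(\<forall>l\<in>{b..b + N - 1}.
            overshoot_prob N c b l =
              (-1) ^ (b + l) * (real b / real l) * real ((N - 1) choose (l - b)) *
              real ((b + N - 1) choose b) \<and>
            (c \<le> 1 / 2 ^ (2 * N - 1) \<longrightarrow> summable (overshoot_coeff N c b l))) \<and>
         finite_overshoot_prob N c b = 1"
proof -
  have range: "{b..b + N - 1} = {b..<b + N}" using assms by auto
  obtain M where M: "N = Suc M" using assms(1) by (cases N) auto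
  have crit: "1 / 2 ^ (2 * N - 1) = (2 / 4 ^ N :: real)"
    by (simp add: M power_mult)
  have "summable (overshoot_coeff N c b l)" if "c \<le> 2 / 4 ^ N" "l \<ge> b" for l
    using overshoot_coeff_sums [OF assms(3) that(1) assms(1,2) that(2)] by (rule sums_summable)
  moreover have "finite_overshoot_prob N c b = 1"
    using sum_landing_eq_1 [of "2 / 4 ^ N" N b] assms
    unfolding finite_overshoot_prob_def range by (simp add: overshoot_prob_critical)
  ultimately show ?thesis
    using sum_step_op_killed_law [of "2 / 4 ^ N" N b] assms
    unfolding range crit by (auto simp: overshoot_prob_critical)
qed

end
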